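(* Let $r\ge1$ be an integer and let $x,y\in|\mathbb{P}^1|$ with $|x|=1$ and $y\neq x$. (i) The set of $\Phi_y^{(x,r)}$-neighbors of $g\in G(\mathbb{A})$ is the set of classes $\{g(\xi_{y,w})_y\mid w\in\mathbb{P}^1(\kappa(y))\}$. Moreover, for every $w\in\mathbb{P}^1(\kappa(y))$, $$m(g,g\xi_{y,w})=\#\{w'\in\mathbb{P}^1(\kappa(y))\mid g\xi_{y,w'}\sim g\xi_{y,w}\}.$$ Therefore every vertex has $q^{|y|}+1$ $\Phi_y^{(x,r)}$-neighbors when counted with multiplicity. (ii) The set of $\Phi_x^{(x,r)}$-neighbors of $g\in G(\mathbb{A})$ is the set of classes of $g\begin{pmatrix}\pi_x&a\pi_x\\0&1\end{pmatrix}$, $a\in\mathbb{F}_q$. Moreover, for every $a\in\mathbb{F}_q$, $$m\left(g,g\begin{pmatrix}\pi_x&a\pi_x\\0&1\end{pmatrix}\right)=\#\left\{a'\in\mathbb{F}_q\ \middle|\ g\begin{pmatrix}\pi_x&a'\pi_x\\0&1\end{pmatrix}\sim g\begin{pmatrix}\pi_x&a\pi_x\\0&1\end{pmatrix}\right\}.$$ Therefore every vertex has $q$ $\Phi_x^{(x,r)}$-neighbors when counted with multiplicity.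
   Context: Let $q$ be a prime power and $F=\mathbb{F}_q(t)$ the function field of $\mathbb{P}^1$ over $\mathbb{F}_q$; $|\mathbb{P}^1|$ is the set of closed points (equivalently, places of $F$). For $z\in|\mathbb{P}^1|$: $F_z$ is the completion of $F$ at $z$, $\mathcal{O}_z$ its ring of integers, $\pi_z\in F$ a uniformizer, $\kappa(z)=\mathcal{O}_z/(\pi_z)$, the degree of $z$ is $|z|=[\kappa(z):\mathbb{F}_q]$, and $|\cdot|_z$ is the absolute value with $|\pi_z|_z=q^{-|z|}$; $\kappa(z)$ is viewed inside $\mathcal{O}_z\cong\kappa(z)[[\pi_z]]$. $\mathbb{A}$ is the adele ring of $F$, $\mathcal{O}_{\mathbb{A}}=\prod_z\mathcal{O}_z$, $G=\mathrm{GL}_2$, $Z$ is the center of $G(\mathbb{A})$, $K=\mathrm{GL}_2(\mathcal{O}_{\mathbb{A}})$, $K_z=\mathrm{GL}_2(\mathcal{O}_z)$. For $h\in\mathrm{GL}_2(F_z)$, $(h)_z$ (or simply $h$) is the adelic matrix equal to $h$ at $z$ and to the identity at all other places; in the claim $\xi_{y,w}$ is placed at $y$ and the matrices in (ii) at $x$. $G(\mathbb{A})$ carries the Haar measure with $\mathrm{vol}(K)=1$. $K^{(x,r)}=\{k\in K_x\mid k\equiv\mathrm{id}\bmod(\pi_x^r)\}\times\prod_{z\neq x}K_z$. For a place $z$ (equal to $x$ or not), $\Phi_z^{(x,r)}$ is the characteristic function of $K^{(x,r)}\begin{pmatrix}\pi_z&0\\0&1\end{pmatrix}K^{(x,r)}$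 (matrix placed at $z$) divided by the volume of $K^{(x,r)}$; it acts on functions by $\Phi(f)(g)=\int_{G(\mathbb{A})}\Phi(h)f(gh)\,dh$. For a place $y$: $\xi_{y,[0:1]}=\begin{pmatrix}1&0\\0&\pi_y\end{pmatrix}$ and $\xi_{y,[1:a]}=\begin{pmatrix}\pi_y&a\\0&1\end{pmatrix}$ for $a\in\kappa(y)$. Write $K'=K^{(x,r)}$. $\mathcal{A}^{K'}$ is the space of functions $f:G(\mathbb{A})\to\mathbb{C}$ that are left $G(F)$-, $Z$- and right $K'$-invariant and of moderate growth: $|f(g)|\le C|g|^N$ for some constants $C,N$, where $|g|=\prod_z|g_z|_z$, $|g_z|_z$ being the maximum of the $z$-adic absolute values of the entries of $g_z$ and of $\det(g_z)^{-1}$. For adelic matrices, $g\sim g'$ means that they have the same class in $G(F)\backslash G(\mathbb{A})/ZK'$; these classes are called vertices. For a bi-$K'$-invariant Hecke operator $\Phi$ and a class $[g]$ there are unique distinct classes $[g_1],\dots,[g_s]$ and nonzero numbers $m_1,\dots,m_s\in\mathbb{C}$ with $\Phi(f)(g)=\sum_i m_if(g_i)$ for all $f\in\mathcal{A}^{K'}$; the $[g_i]$ are the $\Phi$-neighbors of $g$ and $m(g,g_i)=m_i$ is the multiplicity. The number of neighbors counted with multiplicity is $\sum_im_i$.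
   Formalization: In (ii) the upper right entry aπ_x of the matrices is replaced by aπ_x^r (unchanged for r=1); for r≥2 the printed claim is false, e.g. at g=1 with π_x=t the classes with a≠0 are not Φ_x-neighbors. *)

theory Defs
  imports
    "HOL-Algebra.Algebraic_Closure_Type"
    "HOL-Analysis.Analysis"
    "HOL-Computational_Algebra.Computational_Algebra"
begin

unbundle no fps_syntax

section \<open>Places of the rational function field\<close>

text \<open>
  The finite field with \<open>q\<close> elements is a type \<open>'k\<close> of class \<open>finite_field\<close>, \<open>q = CARD('k)\<close>, and
  the function field is \<open>'k poly fract\<close>.  A closed point of the projective line is either the point
  at infinity (\<open>None\<close>) or is given by a monic irreducible polynomial.
\<close>

typedef (overloaded) 'k place =
  "insert None (Some ` {p :: 'k::field poly. Factorial_Ring.irreducible p \<and> lead_coeff p = 1})"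
  morphisms poly_of_place Abs_place
  by blast

text \<open>
  A geometric point above \<open>z\<close>.  Another choice of the root changes everything below by an
  automorphism of the algebraic closure over the constants.
\<close>

definition place_root :: "'k::field place \<Rightarrow> 'k alg_closure" where
  "place_root z = (SOME \<alpha>. poly (map_poly to_ac (the (poly_of_place z))) \<alpha> = 0)"

section \<open>Completions\<close>

text \<open>
  \<open>place_embed z\<close> is the Laurent expansion of rational functions at the geometric point above \<open>z\<close>, in the
  parameter \<open>s = t - \<alpha>\<close> or \<open>s = 1/t\<close>.  As irreducible polynomials over a finite field are
  separable, the \<open>s\<close>-adic valuation restricts to the normalized valuation of \<open>z\<close>; see
  \<open>subdegree_embed_finite\<close> and \<open>subdegree_embed_infinity\<close> below.  Since all fields of Laurent
  series are complete, the closure \<open>local_field z\<close> of the image is the completion at \<open>z\<close>.  In this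
  way all completions have elements of the same type.
\<close>

definition place_coord :: "'k::field place \<Rightarrow> 'k alg_closure fls" where
  "place_coord z =
     (case poly_of_place z of None \<Rightarrow> fls_X_inv | Some p \<Rightarrow> fls_const (place_root z) + fls_X)"

definition expand :: "'k::field place \<Rightarrow> 'k poly \<Rightarrow> 'k alg_closure fls" where
  "expand z a = poly (map_poly (\<lambda>c. fls_const (to_ac c)) a) (place_coord z)"

lemma const_ac_hom:
  "fls_const (to_ac (0::'k::field)) = 0" "fls_const (to_ac (1::'k)) = 1"
  "fls_const (to_ac (a + b :: 'k)) = fls_const (to_ac a) + fls_const (to_ac b)"
  "fls_const (to_ac (a * b :: 'k)) = fls_const (to_ac a) * fls_const (to_ac b)"
  by (simp_all add: fls_plus_const)

lemma expand_0 [simp]: "expand z 0 = 0"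
  and expand_pCons: "expand z (pCons c a) = fls_const (to_ac c) + place_coord z * expand z a"
  by (cases "c = 0 \<and> a = 0"; auto simp: expand_def map_poly_pCons)+

lemma expand_1 [simp]: "expand z 1 = 1"
  by (simp add: one_pCons expand_pCons)

lemma expand_add: "expand z (a + b) = expand z a + expand z b"
  by (induction a b rule: poly_induct2)
     (simp_all add: expand_pCons const_ac_hom(3) algebra_simps del: to_ac_add)

lemma expand_smult: "expand z (smult c a) = fls_const (to_ac c) * expand z a"
  by (induction a) (simp_all add: expand_pCons const_ac_hom(4) algebra_simps del: fls_const_mult_const to_ac_mult)

lemma expand_mult: "expand z (a * b) = expand z a * expand z b"
  by (induction a) (simp_all add: expand_pCons expand_add expand_smult algebra_simps)

lemma expand_uminus: "expand z (- a) = - expand z a"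
  using expand_add[of z a "- a"] by (simp add: add_eq_0_iff)

lemma expand_infinity:
  assumes "poly_of_place z = None" "a \<noteq> 0"
  shows "expand z a \<noteq> 0 \<and> fls_subdegree (expand z a) = - int (degree a)"
  using assms(2)
proof (induction a rule: pCons_induct)
  case (pCons c a)
  have X: "place_coord z = fls_X_inv" using assms by (simp add: place_coord_def)
  show ?case
  proof (cases "a = 0")
    case False
    with pCons have IH: "expand z a \<noteq> 0" "fls_subdegree (expand z a) = - int (degree a)" by auto
    let ?h = "fls_X_inv * expand z a"
    have h: "?h \<noteq> 0" "fls_subdegree ?h = - int (degree a) - 1"
      using IH by simp_all
    have n: "fls_nth (fls_const (to_ac c) + ?h) (- int (degree a) - 1) = fls_nth ?h (- int (degree a) - 1)"
      by simp
    have n0: "fls_nth ?h (- int (degree a) - 1) \<noteq> 0"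
      using nth_fls_subdegree_nonzero[OF h(1)] unfolding h(2) .
    then have "fls_subdegree (fls_const (to_ac c) + ?h) = - int (degree a) - 1"
      using n n0 h(2) by (intro fls_subdegree_eqI) (simp_all del: fls_X_inv_times_conv_shift)
    moreover have "fls_const (to_ac c) + ?h \<noteq> 0"
      using n n0 by (metis fls_zero_nth)
    ultimately show ?thesis using False by (simp add: expand_pCons X)
  qed (use pCons in \<open>auto simp: expand_pCons\<close>)
qed simp

text \<open>At a finite place the expansion is the Taylor expansion at the root.\<close>

lemma expand_finite:
  fixes a :: "'a::field poly"
  assumes "poly_of_place z = Some p"
  shows "expand z a = fps_to_fls (fps_of_poly (map_poly to_ac a \<circ>\<^sub>p [:place_root z, 1:]))"
proof (induction a)
  case (pCons c a)
  have "place_coord z = fps_to_fls (fps_of_poly [:place_root z, 1:])"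
    using assms by (simp add: place_coord_def fps_of_poly_pCons fls_plus_const)
  moreover have "fps_to_fls (fps_of_poly [:d:]) = fls_const d" for d :: "'a alg_closure"
    by (simp add: fps_of_poly_pCons)
  moreover have "map_poly to_ac (pCons c a) = pCons (to_ac c) (map_poly to_ac a)"
    by (simp add: map_poly_pCons)
  ultimately show ?case using pCons
    by (simp only: expand_pCons pcompose_pCons fps_of_poly_add fps_of_poly_mult
        fls_times_fps_to_fls fps_to_fls_plus)
qed simp

lemma expand_nonzero: 
  assumes "a \<noteq> 0" shows "expand z a \<noteq> 0"
proof (cases "poly_of_place z")
  case None
  then show ?thesis using expand_infinity assms by blast
next
  case (Some p)
  have "map_poly to_ac a \<noteq> 0" using assms by (simp add: map_poly_eq_0_iff)
  then have "map_poly to_ac a \<circ>\<^sub>p [:place_root z, 1:] \<noteq> 0"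
    by (simp add: pcompose_eq_0_iff)
  then show ?thesis by (simp add: expand_finite[OF Some])
qed

definition place_embed :: "'k::field place \<Rightarrow> 'k poly fract \<Rightarrow> 'k alg_closure fls" where
  "place_embed z f = (THE h. \<exists>a b. b \<noteq> 0 \<and> f = Fract a b \<and> h = expand z a / expand z b)"

lemma place_embed_Fract:
  assumes "b \<noteq> 0"
  shows "place_embed z (Fract a b) = expand z a / expand z b"
  unfolding place_embed_def
proof (rule the_equality)
  show "\<exists>a' b'. b' \<noteq> 0 \<and> Fract a b = Fract a' b' \<and> expand z a / expand z b = expand z a' / expand z b'"
    using assms by blast
next
  fix h assume "\<exists>a' b'. b' \<noteq> 0 \<and> Fract a b = Fract a' b' \<and> h = expand z a' / expand z b'"
  then obtain a' b' where *: "b' \<noteq> 0" "Fract a b = Fract a' b'" "h = expand z a' / expand z b'" by blast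
  then have "a * b' = a' * b" using assms by (simp add: eq_fract)
  then have "expand z a * expand z b' = expand z a' * expand z b" by (metis expand_mult)
  then show "h = expand z a / expand z b"
    using * assms by (simp add: frac_eq_eq expand_nonzero)
qed

lemma place_embed_0 [simp]: "place_embed z 0 = 0"
  by (simp add: Zero_fract_def place_embed_Fract)

lemma place_embed_1 [simp]: "place_embed z 1 = 1"
  by (simp add: One_fract_def place_embed_Fract)

lemma place_embed_add: "place_embed z (f + g) = place_embed z f + place_embed z g"
  by (cases f; cases g)
     (simp add: place_embed_Fract expand_add expand_mult expand_nonzero add_frac_eq)

lemma place_embed_mult: "place_embed z (f * g) = place_embed z f * place_embed z g"
  by (cases f; cases g) (simp add: place_embed_Fract expand_mult)

lemma place_embed_uminus: "place_embed z (- f) = - place_embed z f"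
  using place_embed_add[of z f "- f"] by (simp add: add_eq_0_iff)

lemma place_embed_eq_0_iff [simp]: "place_embed z f = 0 \<longleftrightarrow> f = 0"
  by (cases f) (auto simp: place_embed_Fract expand_nonzero Zero_fract_def eq_fract dest: contrapos_pp[OF _ expand_nonzero])

lemma subdegree_embed_infinity:
  assumes "poly_of_place z = None" "a \<noteq> 0"
  shows "fls_subdegree (place_embed z (Fract a 1)) = - int (degree a)"
  using expand_infinity[OF assms] by (simp add: place_embed_Fract)

lemma place_root:
  assumes "poly_of_place z = Some p"
  shows "poly (map_poly to_ac p) (place_root z) = 0"
proof -
  have p: "Factorial_Ring.irreducible p"
    using poly_of_place[of z] assms by auto
  then have "degree p > 0"
    by (metis Factorial_Ring.irreducible_def gr0I is_unit_iff_degree)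
  then have "degree (map_poly to_ac p) > 0" by (simp add: degree_map_poly)
  then have "\<exists>\<alpha>. poly (map_poly to_ac p) \<alpha> = 0"
    by (intro alg_closed_imp_poly_has_root)
  then show ?thesis using someI_ex assms unfolding place_root_def by (metis (mono_tags, lifting) option.sel)
qed

lemma map_poly_to_ac_mult: "map_poly to_ac (a * b) = map_poly to_ac a * map_poly to_ac b"
  by (rule poly_eqI) (simp add: coeff_map_poly coeff_mult to_ac_sum)

lemma map_poly_to_ac_add: "map_poly to_ac (a + b) = map_poly to_ac a + map_poly to_ac b"
  by (rule poly_eqI) (simp add: coeff_map_poly)

lemma pderiv_map_poly_to_ac: "pderiv (map_poly to_ac a) = map_poly to_ac (pderiv a)"
  by (rule poly_eqI) (simp add: coeff_map_poly coeff_pderiv)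

lemma irreducible_dvd_of_root:
  fixes p b :: "'k::field poly"
  assumes p: "Factorial_Ring.irreducible p" "poly (map_poly to_ac p) \<alpha> = 0"
    and b: "poly (map_poly to_ac b) \<alpha> = 0"
  shows "p dvd b"
proof -
  define I where "I = {r :: 'k poly. r \<noteq> 0 \<and> poly (map_poly to_ac r) \<alpha> = 0}"
  have "p \<in> I" using p by (auto simp: I_def)
  then obtain d where d: "d \<in> I" "\<And>r. r \<in> I \<Longrightarrow> degree d \<le> degree r"
    using ex_has_least_nat[of "\<lambda>r. r \<in> I" p degree] by blast
  have dvd: "d dvd r" if r: "poly (map_poly to_ac r) \<alpha> = 0" for r
  proof (rule ccontr)
    assume "\<not> d dvd r"
    then have nz: "r mod d \<noteq> 0" by (simp add: dvd_eq_mod_eq_0)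
    have "map_poly to_ac r = map_poly to_ac (r div d * d + r mod d)" by simp
    then have "poly (map_poly to_ac (r mod d)) \<alpha> = 0"
      using r d(1) unfolding map_poly_to_ac_add map_poly_to_ac_mult by (simp add: I_def)
    then have "degree d \<le> degree (r mod d)" using nz d(2) by (simp add: I_def)
    then show False using degree_mod_less[of d r] nz d(1) by (auto simp: I_def)
  qed
  have "\<not> is_unit d"
  proof
    assume "is_unit d"
    moreover have "d \<noteq> 0" using d(1) by (simp add: I_def)
    ultimately have "degree d = 0" by (simp add: is_unit_iff_degree)
    then obtain c where "d = [:c:]" by (rule degree_eq_zeroE)
    then show False using d(1) by (simp add: I_def map_poly_pCons)
  qed
  then have "p dvd d"
    using p(1) dvd[OF p(2)] by (meson irreducibleD')
  then show ?thesis using dvd[OF b] dvd_trans by blast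
qed

lemma finite_degree_le: "finite {r :: 'k::finite_field poly. degree r \<le> n}"
proof (rule finite_subset)
  show "{r :: 'k poly. degree r \<le> n} \<subseteq> Poly ` {xs. set xs \<subseteq> UNIV \<and> length xs \<le> Suc n}"
  proof
    fix r :: "'k poly" assume "r \<in> {r. degree r \<le> n}"
    then have "length (coeffs r) \<le> Suc n"
      by (cases "r = 0") (simp_all add: length_coeffs_degree)
    then show "r \<in> Poly ` {xs. set xs \<subseteq> UNIV \<and> length xs \<le> Suc n}"
      by (intro image_eqI[of _ _ "coeffs r"]) auto
  qed
qed (use finite_lists_length_le[OF finite, of "UNIV :: 'k set"] in auto)

lemma finite_field_separable:
  fixes p :: "'k::finite_field poly"
  assumes "Factorial_Ring.irreducible p" "poly (map_poly to_ac p) \<alpha> = 0"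
  shows "poly (map_poly to_ac (pderiv p)) \<alpha> \<noteq> 0"
proof -
  define c where "c = CHAR('k)"
  have c: "Factorial_Ring.prime c" "c > 0" "CHAR('k poly) = c"
    unfolding c_def by (auto intro!: prime_CHAR_semidom CHAR_pos simp: CHAR_pos_iff)
  have p0: "p \<noteq> 0" using assms(1) by auto
  let ?X = "[:0, 1:] :: 'k poly"
  have "\<not> inj (\<lambda>i::nat. ?X ^ (c ^ i) mod p)"
  proof
    assume "inj (\<lambda>i::nat. ?X ^ (c ^ i) mod p)"
    moreover have "range (\<lambda>i::nat. ?X ^ (c ^ i) mod p) \<subseteq> {r. degree r \<le> degree p}"
    proof safe
      fix i :: nat
      show "degree (?X ^ (c ^ i) mod p) \<le> degree p"
        using degree_mod_less[OF p0, of "?X ^ (c ^ i)"] by auto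
    qed
    ultimately show False
      using finite_degree_le finite_subset range_inj_infinite by blast
  qed
  then obtain i j :: nat where ij: "i < j" "?X ^ (c ^ i) mod p = ?X ^ (c ^ j) mod p"
    unfolding inj_def by (metis nat_neq_iff)
  define P where "P = ?X ^ (c ^ (j - i)) - ?X"
  have "P ^ (c ^ i) = ?X ^ (c ^ j) - ?X ^ (c ^ i)"
  proof -
    have "(P + ?X) ^ (c ^ i) = P ^ (c ^ i) + ?X ^ (c ^ i)"
      using c by (intro freshmans_dream') auto
    moreover have "P + ?X = ?X ^ (c ^ (j - i))" by (simp add: P_def)
    moreover have "c ^ (j - i) * c ^ i = c ^ j" using ij(1) by (simp flip: power_add)
    ultimately show ?thesis by (simp flip: power_mult)
  qed
  moreover have "p dvd ?X ^ (c ^ j) - ?X ^ (c ^ i)"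
    using ij(2) by (intro mod_eq_dvd_iff[THEN iffD1]) simp
  ultimately have "p dvd P ^ (c ^ i)" by simp
  then obtain u where u: "P ^ (c ^ i) = p * u" by (elim dvdE)
  have pow: "map_poly to_ac (P ^ n) = map_poly to_ac P ^ n" for n
    by (induction n) (simp_all add: map_poly_to_ac_mult)
  have "poly (map_poly to_ac (P ^ (c ^ i))) \<alpha> = 0"
    by (simp add: u map_poly_to_ac_mult assms(2))
  then have "poly (map_poly to_ac P) \<alpha> ^ (c ^ i) = 0"
    by (simp only: pow poly_power)
  then have "p dvd P"
    using assms by (intro irreducible_dvd_of_root) auto
  then obtain h where h: "P = p * h" by (elim dvdE)
  have "of_nat c = (0 :: 'k)" by (simp add: c_def)
  then have "pderiv P = - 1"
    using ij(1) by (simp add: zero_power P_def pderiv_diff pderiv_power pderiv_pCons one_pCons)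
  then have "p * pderiv h + h * pderiv p = - 1" by (simp add: h pderiv_mult)
  then have "poly (map_poly to_ac (p * pderiv h + h * pderiv p)) \<alpha> = poly (map_poly to_ac (- 1)) \<alpha>"
    by (rule arg_cong)
  then have "poly (map_poly to_ac h) \<alpha> * poly (map_poly to_ac (pderiv p)) \<alpha> = poly (map_poly to_ac (- 1)) \<alpha>"
    using assms(2) by (simp only: map_poly_to_ac_add map_poly_to_ac_mult poly_add poly_mult mult_zero_left add_0)
  moreover have "map_poly to_ac (- 1 :: 'k poly) = - 1"
    by (rule poly_eqI) (simp add: coeff_map_poly one_pCons coeff_pCons split: nat.splits)
  ultimately have "poly (map_poly to_ac h) \<alpha> * poly (map_poly to_ac (pderiv p)) \<alpha> = - 1"
    by (simp only: poly_minus poly_1)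
  then show ?thesis by (intro notI) (simp only: mult_zero_right neg_equal_0_iff_equal zero_neq_one neg_0_equal_iff_equal)
qed

lemma subdegree_embed_finite:
  fixes z :: "'k::finite_field place"
  assumes "poly_of_place z = Some p" and b: "a = p ^ n * b" "\<not> p dvd b"
  shows "fls_subdegree (place_embed z (Fract a 1)) = int n"
proof -
  have p: "Factorial_Ring.irreducible p" using poly_of_place[of z] assms(1) by auto
  then have nu: "p \<noteq> 0" by auto
  let ?\<alpha> = "place_root z"
  have nth: "fls_nth (expand z b) 0 = poly (map_poly to_ac b) ?\<alpha>"
    "fls_nth (expand z b) 1 = poly (map_poly to_ac (pderiv b)) ?\<alpha>" "fls_nth (expand z b) k = 0" if "k < 0" for b k
  proof -
    let ?B = "map_poly to_ac b \<circ>\<^sub>p [:?\<alpha>, 1:]"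
    have e: "fls_nth (expand z b) (int m) = coeff ?B m" for m
      by (simp add: expand_finite[OF assms(1)])
    have "coeff ?B 0 = poly ?B 0" by (rule poly_0_coeff_0[symmetric])
    then show "fls_nth (expand z b) 0 = poly (map_poly to_ac b) ?\<alpha>"
      using e[of 0] by (simp only: poly_pcompose) simp
    have "coeff ?B 1 = coeff (pderiv ?B) 0" by (simp only: coeff_pderiv) simp
    also have "\<dots> = poly (pderiv ?B) 0" by (rule poly_0_coeff_0[symmetric])
    also have "\<dots> = poly (map_poly to_ac (pderiv b)) ?\<alpha>"
      by (simp only: pderiv_pcompose poly_mult poly_pcompose pderiv_map_poly_to_ac) (simp add: pderiv_pCons)
    finally show "fls_nth (expand z b) 1 = poly (map_poly to_ac (pderiv b)) ?\<alpha>"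
      using e[of 1] by simp
    show "fls_nth (expand z b) k = 0" using that by (simp add: expand_finite[OF assms(1)])
  qed
  have sp: "fls_subdegree (expand z p) = 1"
  proof (rule fls_subdegree_eqI)
    show "fls_nth (expand z p) 1 \<noteq> 0"
      using nth(2)[of "-1" p] finite_field_separable[OF p place_root[OF assms(1)]] by simp
    fix k :: int assume "k < 1"
    then consider "k = 0" | "k < 0" by linarith
    then show "fls_nth (expand z p) k = 0"
    proof cases
      case 1
      then show ?thesis using nth(1)[of "-1" p] place_root[OF assms(1)] by simp
    next
      case 2
      then show ?thesis by (rule nth(3))
    qed
  qed
  have sb: "fls_subdegree (expand z b) = 0"
  proof (rule fls_subdegree_eqI)
    show "fls_nth (expand z b) 0 \<noteq> 0"
    proof
      assume "fls_nth (expand z b) 0 = 0"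
      then have "poly (map_poly to_ac b) ?\<alpha> = 0" using nth(1)[of "-1" b] by simp
      then have "p dvd b" by (rule irreducible_dvd_of_root[OF p place_root[OF assms(1)]])
      then show False using b(2) by simp
    qed
  qed (rule nth(3))
  have pow: "expand z (p ^ m) = expand z p ^ m" for m
    by (induction m) (simp_all add: expand_mult)
  have b0: "b \<noteq> 0" using b(2) by auto
  have "place_embed z (Fract a 1) = expand z (p ^ n) * expand z b"
    unfolding b(1) by (simp add: place_embed_Fract expand_mult)
  also have "fls_subdegree \<dots> = fls_subdegree (expand z p ^ n) + fls_subdegree (expand z b)"
    unfolding pow using nu b0 by (intro fls_subdegree_mult) (simp_all add: expand_nonzero)
  also have "fls_subdegree (expand z p ^ n) = int n * fls_subdegree (expand z p)"
    by (rule fls_subdegree_pow)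
  finally show ?thesis by (simp add: sp sb)
qed


definition local_field :: "'k::field place \<Rightarrow> 'k alg_closure fls set" where
  "local_field z = closure (range (place_embed z))"

definition local_int :: "'k::field place \<Rightarrow> 'k alg_closure fls set" where
  "local_int z = {a \<in> local_field z. 0 \<le> fls_subdegree a}"

text \<open>
  The residue field of \<open>local_int z\<close> is the image of the reduction map (constant coefficient), whose
  kernel is the maximal ideal.  Its elements are viewed in \<open>local_int z\<close> as constant series.
\<close>

definition residue_field :: "'k::field place \<Rightarrow> 'k alg_closure set" where
  "residue_field z = (\<lambda>a. fls_nth a 0) ` local_int z"

definition place_degree :: "'k::field place \<Rightarrow> nat" where
  "place_degree z = vector_space.dim (\<lambda>c v. to_ac c * v) (residue_field z)"

definition local_abs :: "'k::finite_field place \<Rightarrow> 'k alg_closure fls \<Rightarrow> real" where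
  "local_abs z a =
     (if a = 0 then 0 else real (CARD('k) ^ place_degree z) powi (- fls_subdegree a))"

definition uniformizer :: "'k::field place \<Rightarrow> 'k poly fract \<Rightarrow> bool" where
  "uniformizer z f \<longleftrightarrow> fls_subdegree (place_embed z f) = 1"

lemma fls_vanish_mult:
  fixes c d :: "'a::field fls"
  assumes "\<forall>i<m. fls_nth c i = 0" "\<forall>i<n. fls_nth d i = 0"
  shows "\<forall>i<m + n. fls_nth (c * d) i = 0"
proof (cases "c = 0 \<or> d = 0")
  case False
  then have "m \<le> fls_subdegree c" "n \<le> fls_subdegree d"
    using assms by (auto intro: fls_subdegree_geI)
  then have "m + n \<le> fls_subdegree (c * d)" using False by simp
  then show ?thesis by (meson fls_eq0_below_subdegree less_le_trans)
qed auto

lemma local_field_iff: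
  "a \<in> local_field z \<longleftrightarrow> (\<forall>n. \<exists>f. \<forall>i<n. fls_nth (place_embed z f) i = fls_nth a i)"
proof
  assume a: "a \<in> local_field z"
  show "\<forall>n. \<exists>f. \<forall>i<n. fls_nth (place_embed z f) i = fls_nth a i"
  proof
    fix n :: int
    obtain f where f: "dist (place_embed z f) a < inverse (2 ^ nat n)"
      using a unfolding local_field_def closure_approachable
      by (metis (no_types, lifting) imageE inverse_positive_iff_positive zero_less_numeral zero_less_power)
    have "fls_nth (place_embed z f) i = fls_nth a i" if "i < n" for i
    proof (cases "place_embed z f = a")
      case False
      let ?d = "fls_subdegree (place_embed z f - a)"
      have "n \<le> ?d"
      proof (rule ccontr)
        assume "\<not> n \<le> ?d"
        then have "nat ?d \<le> nat n" by simp
        then have "inverse (2 ^ nat n) \<le> inverse (2 ^ nat ?d :: real)"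
          by (simp add: power_increasing)
        moreover have "inverse (2 ^ nat n) \<le> (1::real)" "(1::real) \<le> 2 ^ nat (- ?d)"
          by (simp_all add: inverse_le_1_iff)
        ultimately show False using f False unfolding dist_fls_def
          by (smt (verit))
      qed
      then have "fls_nth (place_embed z f - a) i = 0" using that by (intro fls_eq0_below_subdegree) simp
      then show ?thesis by simp
    qed simp
    then show "\<exists>f. \<forall>i<n. fls_nth (place_embed z f) i = fls_nth a i" by blast
  qed
next
  assume *: "\<forall>n. \<exists>f. \<forall>i<n. fls_nth (place_embed z f) i = fls_nth a i"
  show "a \<in> local_field z"
    unfolding local_field_def closure_approachable
  proof (intro allI impI)
    fix e :: real assume "e > 0"
    then obtain n where n: "inverse (2 ^ n) < e"
      using real_arch_pow_inv[of e "1/2"] by (auto simp: power_one_over inverse_eq_divide)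
    obtain f where f: "\<forall>i<int n. fls_nth (place_embed z f) i = fls_nth a i" using * by blast
    have "dist (place_embed z f) a < e"
    proof (cases "place_embed z f = a")
      case False
      let ?d = "fls_subdegree (place_embed z f - a)"
      have "int n \<le> ?d" using f False by (intro fls_subdegree_geI) auto
      then have "dist (place_embed z f) a = inverse (2 ^ nat ?d)" "n \<le> nat ?d"
        using False by (auto simp: dist_fls_def)
      moreover from this have "inverse (2 ^ nat ?d) \<le> inverse (2 ^ n :: real)"
        by (simp add: power_increasing)
      ultimately show ?thesis using n by linarith
    qed (use \<open>e > 0\<close> in simp)
    then show "\<exists>y\<in>range (place_embed z). dist y a < e" by blast
  qed
qed

lemma place_embed_local_field [simp]: "place_embed z f \<in> local_field z"
  unfolding local_field_def by (rule subsetD[OF closure_subset rangeI])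

lemma local_field_0 [simp]: "0 \<in> local_field z"
  using place_embed_local_field[of z 0] by simp

lemma local_field_1 [simp]: "1 \<in> local_field z"
  using place_embed_local_field[of z 1] by simp

lemma local_field_add:
  assumes "a \<in> local_field z" "b \<in> local_field z" shows "a + b \<in> local_field z"
  unfolding local_field_iff
proof
  fix n
  obtain f g where "\<forall>i<n. fls_nth (place_embed z f) i = fls_nth a i"
    "\<forall>i<n. fls_nth (place_embed z g) i = fls_nth b i"
    using assms unfolding local_field_iff by blast
  then show "\<exists>h. \<forall>i<n. fls_nth (place_embed z h) i = fls_nth (a + b) i"
    by (intro exI[of _ "f + g"]) (simp add: place_embed_add)
qed

lemma local_field_uminus:
  assumes "a \<in> local_field z" shows "- a \<in> local_field z"
  unfolding local_field_iff
proof
  fix n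
  obtain f where "\<forall>i<n. fls_nth (place_embed z f) i = fls_nth a i"
    using assms unfolding local_field_iff by blast
  then show "\<exists>h. \<forall>i<n. fls_nth (place_embed z h) i = fls_nth (- a) i"
    by (intro exI[of _ "- f"]) (simp add: place_embed_uminus)
qed

lemma local_field_diff:
  assumes "a \<in> local_field z" "b \<in> local_field z" shows "a - b \<in> local_field z"
  using local_field_add[OF assms(1) local_field_uminus[OF assms(2)]] by simp

lemma local_field_mult:
  assumes "a \<in> local_field z" "b \<in> local_field z" shows "a * b \<in> local_field z"
  unfolding local_field_iff
proof
  fix n
  define k l where "k = min 0 (fls_subdegree a)" "l = min 0 (fls_subdegree b)"
  define N where "N = max 0 (n - k - l)"
  obtain f g where fg: "\<forall>i<N. fls_nth (place_embed z f) i = fls_nth a i"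
    "\<forall>i<N. fls_nth (place_embed z g) i = fls_nth b i"
    using assms unfolding local_field_iff by blast
  let ?A = "place_embed z f" and ?B = "place_embed z g"
  have a: "\<forall>i<k. fls_nth a i = 0" and b: "\<forall>i<l. fls_nth b i = 0"
    by (auto simp: k_l_def)
  have B: "\<forall>i<l. fls_nth ?B i = 0" using fg(2) b by (auto simp: N_def k_l_def)
  have 1: "\<forall>i<N + l. fls_nth ((?A - a) * ?B) i = 0"
    using fg(1) B by (intro fls_vanish_mult) auto
  have 2: "\<forall>i<k + N. fls_nth (a * (?B - b)) i = 0"
    using fg(2) a by (intro fls_vanish_mult) auto
  have "fls_nth (?A * ?B) i = fls_nth (a * b) i" if "i < n" for i
  proof -
    have "i < N + l" "i < k + N" using that by (auto simp: N_def k_l_def)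
    then have "fls_nth ((?A - a) * ?B + a * (?B - b)) i = 0" using 1 2 by simp
    moreover have "(?A - a) * ?B + a * (?B - b) = ?A * ?B - a * b" by (simp add: algebra_simps)
    ultimately show ?thesis by simp
  qed
  then show "\<exists>h. \<forall>i<n. fls_nth (place_embed z h) i = fls_nth (a * b) i"
    by (intro exI[of _ "f * g"]) (simp add: place_embed_mult)
qed

lemma local_int_iff: "a \<in> local_int z \<longleftrightarrow> a \<in> local_field z \<and> (\<forall>i<0. fls_nth a i = 0)"
  by (cases "a = 0") (auto simp: local_int_def intro: fls_subdegree_geI)

lemma local_int_0 [simp]: "0 \<in> local_int z"
  and local_int_1 [simp]: "1 \<in> local_int z"
  and local_int_uminus: "a \<in> local_int z \<Longrightarrow> - a \<in> local_int z"
  and local_int_add: "a \<in> local_int z \<Longrightarrow> b \<in> local_int z \<Longrightarrow> a + b \<in> local_int z"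
  and local_int_diff: "a \<in> local_int z \<Longrightarrow> b \<in> local_int z \<Longrightarrow> a - b \<in> local_int z"
  and local_int_mult: "a \<in> local_int z \<Longrightarrow> b \<in> local_int z \<Longrightarrow> a * b \<in> local_int z"
  using fls_vanish_mult[of 0 a 0 b]
  by (auto simp: local_int_iff local_field_uminus local_field_add local_field_diff local_field_mult)

section \<open>Adeles\<close>

typedef (overloaded) 'k adele =
  "{a :: 'k::field place \<Rightarrow> 'k alg_closure fls.
      (\<forall>z. a z \<in> local_field z) \<and> finite {z. a z \<notin> local_int z}}"
  morphisms adele_nth Abs_adele
  by (rule exI[of _ "\<lambda>_. 0"]) simp

setup_lifting type_definition_adele

lemma adele_closed:
  assumes "finite {z. a z \<notin> local_int z}" "finite {z. b z \<notin> local_int z}"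
    and "\<And>z. a z \<in> local_int z \<Longrightarrow> b z \<in> local_int z \<Longrightarrow> c z \<in> local_int z"
  shows "finite {z. c z \<notin> local_int z}"
proof -
  have "{z. c z \<notin> local_int z} \<subseteq> {z. a z \<notin> local_int z} \<union> {z. b z \<notin> local_int z}"
    using assms(3) by blast
  then show ?thesis using assms(1,2) by (meson finite_UnI finite_subset)
qed

instantiation adele :: (field) comm_ring_1
begin

lift_definition zero_adele :: "'a adele" is "\<lambda>_. 0" by simp

lift_definition one_adele :: "'a adele" is "\<lambda>_. 1" by simp

lift_definition plus_adele :: "'a adele \<Rightarrow> 'a adele \<Rightarrow> 'a adele" is "\<lambda>a b z. a z + b z"
  subgoal for a b
    using adele_closed[of a b "\<lambda>z. a z + b z"] by (auto intro: local_field_add local_int_add)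
  done

lift_definition minus_adele :: "'a adele \<Rightarrow> 'a adele \<Rightarrow> 'a adele" is "\<lambda>a b z. a z - b z"
  subgoal for a b
    using adele_closed[of a b "\<lambda>z. a z - b z"] by (auto intro: local_field_diff local_int_diff)
  done

lift_definition uminus_adele :: "'a adele \<Rightarrow> 'a adele" is "\<lambda>a z. - a z"
  subgoal for a
    using adele_closed[of a a "\<lambda>z. - a z"] by (auto intro: local_field_uminus local_int_uminus)
  done

lift_definition times_adele :: "'a adele \<Rightarrow> 'a adele \<Rightarrow> 'a adele" is "\<lambda>a b z. a z * b z"
  subgoal for a b
    using adele_closed[of a b "\<lambda>z. a z * b z"] by (auto intro: local_field_mult local_int_mult)
  done

instance
proof
  show "(0::'a adele) \<noteq> 1" by transfer (metis zero_neq_one)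
qed (transfer; simp add: fun_eq_iff algebra_simps)+

end

text \<open>The restricted product topology with respect to the open subrings \<open>local_int z\<close>.\<close>

definition adele_nbhd :: "'k::field adele \<Rightarrow> 'k place set \<Rightarrow> real \<Rightarrow> 'k adele set" where
  "adele_nbhd a S e =
     {b. (\<forall>z\<in>S. dist (adele_nth b z) (adele_nth a z) < e) \<and>
         (\<forall>z. z \<notin> S \<longrightarrow> adele_nth b z - adele_nth a z \<in> local_int z)}"

instantiation adele :: (field) topological_space
begin

definition open_adele :: "'a adele set \<Rightarrow> bool" where
  "open_adele U \<longleftrightarrow> (\<forall>a\<in>U. \<exists>S e. finite S \<and> 0 < e \<and> adele_nbhd a S e \<subseteq> U)"

instance
proof
  show "open (UNIV :: 'a adele set)"
    unfolding open_adele_def by (auto intro!: exI[of _ "{}"] exI[of _ 1])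
next
  fix U V :: "'a adele set" assume UV: "open U" "open V"
  show "open (U \<inter> V)"
    unfolding open_adele_def
  proof
    fix a assume a: "a \<in> U \<inter> V"
    obtain S d where 1: "finite S" "0 < d" "adele_nbhd a S d \<subseteq> U"
      using UV(1) a unfolding open_adele_def by blast
    obtain T e where 2: "finite T" "0 < e" "adele_nbhd a T e \<subseteq> V"
      using UV(2) a unfolding open_adele_def by blast
    define m where "m = min 1 (min d e)"
    have int: "adele_nth b z - adele_nth a z \<in> local_int z"
      if "dist (adele_nth b z) (adele_nth a z) < m" for b z
    proof -
      have "adele_nth b z - adele_nth a z \<in> local_field z"
        using adele_nth[of a] adele_nth[of b] by (auto intro: local_field_diff)
      moreover have "0 \<le> fls_subdegree (adele_nth b z - adele_nth a z)"
      proof (rule ccontr)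
        assume *: "\<not> 0 \<le> fls_subdegree (adele_nth b z - adele_nth a z)"
        then have "adele_nth b z \<noteq> adele_nth a z" by auto
        then have "dist (adele_nth b z) (adele_nth a z) =
            2 ^ nat (- fls_subdegree (adele_nth b z - adele_nth a z))"
          using * by (simp add: dist_fls_def)
        moreover have "(1::real) \<le> 2 ^ k" for k by simp
        ultimately have "1 \<le> dist (adele_nth b z) (adele_nth a z)" by metis
        then show False using that by (simp add: m_def)
      qed
      ultimately show ?thesis by (simp add: local_int_def)
    qed
    have "adele_nbhd a (S \<union> T) m \<subseteq> adele_nbhd a S d \<inter> adele_nbhd a T e"
    proof
      fix b assume b: "b \<in> adele_nbhd a (S \<union> T) m"
      have lt: "dist (adele_nth b z) (adele_nth a z) < m" if "z \<in> S \<union> T" for z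
        using b that unfolding adele_nbhd_def by blast
      have all: "adele_nth b z - adele_nth a z \<in> local_int z" for z
      proof (cases "z \<in> S \<union> T")
        case True
        then show ?thesis by (rule int[OF lt])
      next
        case False
        then show ?thesis using b unfolding adele_nbhd_def by blast
      qed
      have "m \<le> d" "m \<le> e" by (simp_all add: m_def)
      then have "\<forall>z\<in>S. dist (adele_nth b z) (adele_nth a z) < d"
        "\<forall>z\<in>T. dist (adele_nth b z) (adele_nth a z) < e"
        by (metis UnI1 lt less_le_trans, metis UnI2 lt less_le_trans)
      then show "b \<in> adele_nbhd a S d \<inter> adele_nbhd a T e" using all unfolding adele_nbhd_def by blast
    qed
    then have "adele_nbhd a (S \<union> T) m \<subseteq> U \<inter> V" using 1 2 by blast
    moreover have "finite (S \<union> T)" "0 < m" using 1 2 by (auto simp: m_def)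
    ultimately show "\<exists>S e. finite S \<and> 0 < e \<and> adele_nbhd a S e \<subseteq> U \<inter> V" by blast
  qed
next
  fix K :: "'a adele set set" assume K: "\<forall>U\<in>K. open U"
  show "open (\<Union>K)"
    unfolding open_adele_def
  proof
    fix a assume "a \<in> \<Union>K"
    then obtain U where "U \<in> K" "a \<in> U" by blast
    then show "\<exists>S e. finite S \<and> 0 < e \<and> adele_nbhd a S e \<subseteq> \<Union>K"
      using K[unfolded open_adele_def, rule_format, of U a] by (meson Union_upper subset_trans)
  qed
qed

end

definition principal_adele :: "'k::field poly fract \<Rightarrow> 'k adele" where
  "principal_adele f = Abs_adele (\<lambda>z. place_embed z f)"

lemma adele_nth_principal_adele:
  fixes f :: "'k::finite_field poly fract"
  shows "adele_nth (principal_adele f) z = place_embed z f"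
proof -
  obtain a b where f: "f = Fract a b" "b \<noteq> 0" by (cases f)
  have "poly_of_place z \<in> insert None (Some ` {p. degree p \<le> degree b})"
    if z: "place_embed z f \<notin> local_int z" for z
  proof (cases "poly_of_place z")
    case (Some p)
    have "degree p \<le> degree b"
    proof (rule ccontr)
      assume "\<not> degree p \<le> degree b"
      then have "\<not> p dvd b" using f(2) dvd_imp_degree_le[of p b] by auto
      then have b: "fls_subdegree (expand z b) = 0"
        using subdegree_embed_finite[OF Some, of b 0 b] by (simp add: place_embed_Fract)
      have a: "0 \<le> fls_subdegree (expand z a)"
        unfolding expand_finite[OF Some] by (rule fls_subdegree_fls_to_fps_gt0)
      have "0 \<le> fls_subdegree (place_embed z f)"
      proof (cases "a = 0")
        case False
        then show ?thesis
          using a b f(2)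
          by (simp add: f(1) place_embed_Fract divide_inverse expand_nonzero fls_inverse_subdegree)
      qed (simp add: f place_embed_Fract)
      then show False using z by (simp add: local_int_def)
    qed
    then show ?thesis using Some by simp
  qed simp
  then have "poly_of_place ` {z. place_embed z f \<notin> local_int z}
      \<subseteq> insert None (Some ` {p. degree p \<le> degree b})"
    by (intro image_subsetI) (simp only: mem_Collect_eq)
  moreover have "finite (insert None (Some ` {p :: 'k poly. degree p \<le> degree b}))"
    by (intro finite.insertI finite_imageI finite_degree_le)
  ultimately have "finite (poly_of_place ` {z. place_embed z f \<notin> local_int z})"
    by (rule finite_subset)
  then have "finite {z. place_embed z f \<notin> local_int z}"
    by (rule finite_imageD) (simp add: inj_on_def poly_of_place_inject)
  then show ?thesis unfolding principal_adele_def by (subst Abs_adele_inverse) auto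
qed

definition adele_int :: "'k::field adele set" where
  "adele_int = {a. \<forall>z. adele_nth a z \<in> local_int z}"

section \<open>The group \<open>GL\<^sub>2\<close>\<close>

definition mat2 :: "'a::zero \<Rightarrow> 'a \<Rightarrow> 'a \<Rightarrow> 'a \<Rightarrow> 'a^2^2" where
  "mat2 a b c d = vector [vector [a, b], vector [c, d]]"

definition GL2 :: "'a::comm_ring_1 set \<Rightarrow> ('a^2^2) set" where
  "GL2 R = {g. (\<forall>i j. g $ i $ j \<in> R) \<and>
     (\<exists>h. (\<forall>i j. h $ i $ j \<in> R) \<and> g ** h = mat 1 \<and> h ** g = mat 1)}"

abbreviation GL2_adele :: "('k::field adele^2^2) set" where
  "GL2_adele \<equiv> GL2 UNIV"

definition GL2_global :: "('k::field adele^2^2) set" where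
  "GL2_global = map_matrix principal_adele ` GL2 UNIV"

definition GL2_center :: "('k::field adele^2^2) set" where
  "GL2_center = {\<zeta> \<in> GL2_adele. \<forall>g\<in>GL2_adele. \<zeta> ** g = g ** \<zeta>}"

definition component :: "'k::field place \<Rightarrow> 'k adele^2^2 \<Rightarrow> 'k alg_closure fls^2^2" where
  "component z g = map_matrix (\<lambda>a. adele_nth a z) g"

definition at_place :: "'k::field place \<Rightarrow> 'k alg_closure fls^2^2 \<Rightarrow> 'k adele^2^2" where
  "at_place z h = (\<chi> i j. Abs_adele (\<lambda>w. if w = z then h $ i $ j else mat 1 $ i $ j))"

text \<open>
  The topology of \<open>GL2_adele\<close> is induced by \<open>g \<mapsto> (g, g\<^sup>-\<^sup>1)\<close> from the product topology on pairs of
  matrices.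
\<close>

definition GL2_topology :: "('k::field adele^2^2) topology" where
  "GL2_topology = pullback_topology GL2_adele (\<lambda>g. (g, matrix_inv g)) euclidean"

definition haar_measure :: "('k::field adele^2^2) measure \<Rightarrow> bool" where
  "haar_measure \<mu> \<longleftrightarrow>
     space \<mu> = GL2_adele \<and>
     sets \<mu> = sigma_sets GL2_adele {U. openin GL2_topology U} \<and>
     emeasure \<mu> (space \<mu>) \<noteq> 0 \<and>
     (\<forall>g\<in>GL2_adele. \<forall>A\<in>sets \<mu>. emeasure \<mu> ((**) g ` A) = emeasure \<mu> A) \<and>
     (\<forall>C. compactin GL2_topology C \<longrightarrow> emeasure \<mu> C < \<infinity>) \<and>
     (\<forall>A\<in>sets \<mu>. emeasure \<mu> A = (INF U\<in>{U. openin GL2_topology U \<and> A \<subseteq> U}. emeasure \<mu> U)) \<and>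
     (\<forall>U. openin GL2_topology U \<longrightarrow>
        emeasure \<mu> U = (SUP C\<in>{C. compactin GL2_topology C \<and> C \<subseteq> U}. emeasure \<mu> C))"

text \<open>
  In the following, \<open>\<pi>\<close> is a choice of a uniformizer in the function field at every place.
  \<open>level_group \<pi> x r\<close> consists of the integral matrices that are trivial modulo \<open>\<pi>\<^sub>x\<^sup>r\<close>.
\<close>

definition level_group ::
  "('k::field place \<Rightarrow> 'k poly fract) \<Rightarrow> 'k place \<Rightarrow> nat \<Rightarrow> ('k adele^2^2) set" where
  "level_group \<pi> x r =
     {k. component x k \<in> GL2 (local_int x) \<and>
         (\<forall>i j. \<exists>c\<in>local_int x. component x k $ i $ j - mat 1 $ i $ j = place_embed x (\<pi> x) ^ r * c) \<and>
         (\<forall>z. z \<noteq> x \<longrightarrow> component z k \<in> GL2 (local_int z))}"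

section \<open>Automorphic functions and Hecke operators\<close>

definition local_height :: "'k::finite_field place \<Rightarrow> 'k alg_closure fls^2^2 \<Rightarrow> real" where
  "local_height z h = Max (insert (local_abs z (inverse (det h))) {local_abs z (h $ i $ j) | i j. True})"

text \<open>Almost all factors of the following product are equal to 1.\<close>

definition height :: "'k::finite_field adele^2^2 \<Rightarrow> real" where
  "height g = (\<Prod>z | local_height z (component z g) \<noteq> 1. local_height z (component z g))"

definition automorphic :: "('k::finite_field adele^2^2) set \<Rightarrow> ('k adele^2^2 \<Rightarrow> complex) set" where
  "automorphic K = {f.
     (\<forall>g\<in>GL2_adele.
        (\<forall>\<gamma>\<in>GL2_global. f (\<gamma> ** g) = f g) \<and>
        (\<forall>\<zeta>\<in>GL2_center. f (\<zeta> ** g) = f g) \<and>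
        (\<forall>k\<in>K. f (g ** k) = f g)) \<and>
     (\<exists>C N::real. \<forall>g\<in>GL2_adele. cmod (f g) \<le> C * height g powr N)}"

definition vertex :: "('k::field adele^2^2) set \<Rightarrow> 'k adele^2^2 \<Rightarrow> ('k adele^2^2) set" where
  "vertex K g = {\<gamma> ** g ** (\<zeta> ** k) | \<gamma> \<zeta> k. \<gamma> \<in> GL2_global \<and> \<zeta> \<in> GL2_center \<and> k \<in> K}"

definition hecke_kernel ::
  "('k::field adele^2^2) measure \<Rightarrow> ('k place \<Rightarrow> 'k poly fract) \<Rightarrow> 'k place \<Rightarrow> nat \<Rightarrow> 'k place \<Rightarrow>
    'k adele^2^2 \<Rightarrow> complex" where
  "hecke_kernel \<mu> \<pi> x r z h =
     indicator {k ** at_place z (mat2 (place_embed z (\<pi> z)) 0 0 1) ** k' | k k'.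
                  k \<in> level_group \<pi> x r \<and> k' \<in> level_group \<pi> x r} h
     / complex_of_real (measure \<mu> (level_group \<pi> x r))"

definition hecke_action ::
  "('k::field adele^2^2) measure \<Rightarrow> ('k adele^2^2 \<Rightarrow> complex) \<Rightarrow> ('k adele^2^2 \<Rightarrow> complex) \<Rightarrow>
    'k adele^2^2 \<Rightarrow> complex" where
  "hecke_action \<mu> \<Phi> f g = (LINT h|\<mu>. \<Phi> h * f (g ** h))"

text \<open>
  \<open>multiplicities \<mu> K \<Phi> g\<close> is the function \<open>m\<close> on vertices, extended by 0 to vertices that are not
  neighbors and to sets that are not vertices, with \<open>\<Phi>(f)(g) = \<Sum> m(v) f(v)\<close> for all automorphic \<open>f\<close>.
  Here \<open>the_elem (f ` v)\<close> is the value of \<open>f\<close> on the class \<open>v\<close>, on which \<open>f\<close> is constant.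
\<close>

definition multiplicities ::
  "('k::finite_field adele^2^2) measure \<Rightarrow> ('k adele^2^2) set \<Rightarrow> ('k adele^2^2 \<Rightarrow> complex) \<Rightarrow>
    'k adele^2^2 \<Rightarrow> ('k adele^2^2) set \<Rightarrow> complex" where
  "multiplicities \<mu> K \<Phi> g = (THE m.
     finite {v. m v \<noteq> 0} \<and> {v. m v \<noteq> 0} \<subseteq> vertex K ` GL2_adele \<and>
     (\<forall>f\<in>automorphic K. hecke_action \<mu> \<Phi> f g = (\<Sum>v | m v \<noteq> 0. m v * the_elem (f ` v))))"

definition neighbors ::
  "('k::finite_field adele^2^2) measure \<Rightarrow> ('k adele^2^2) set \<Rightarrow> ('k adele^2^2 \<Rightarrow> complex) \<Rightarrow>
    'k adele^2^2 \<Rightarrow> ('k adele^2^2) set set" where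
  "neighbors \<mu> K \<Phi> g = {v. multiplicities \<mu> K \<Phi> g v \<noteq> 0}"

text \<open>
  The points of the projective line over a field in normalized homogeneous coordinates: \<open>Pt01\<close>
  is \<open>[0:1]\<close> and \<open>Pt1 a\<close> is \<open>[1:a]\<close>.
\<close>

datatype 'a proj_point = Pt01 | Pt1 'a

definition proj_line :: "'a set \<Rightarrow> 'a proj_point set" where
  "proj_line R = insert Pt01 (Pt1 ` R)"

fun xi :: "('k::field place \<Rightarrow> 'k poly fract) \<Rightarrow> 'k place \<Rightarrow> 'k alg_closure proj_point \<Rightarrow>
    'k alg_closure fls^2^2" where
  "xi \<pi> y Pt01 = mat2 1 0 0 (place_embed y (\<pi> y))"
| "xi \<pi> y (Pt1 a) = mat2 (place_embed y (\<pi> y)) (fls_const a) 0 1"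

text \<open>
  The representatives at the ramified place.  The upper right entry is a multiple of \<open>\<pi>\<^sub>x\<^sup>r\<close>: with
  \<open>d = diag(\<pi>\<^sub>x, 1)\<close> and \<open>K\<close> the level group, \<open>K \<inter> d K d\<^sup>-\<^sup>1\<close> is the subgroup of \<open>K\<close> of
  index \<open>q\<close> given by the condition that the upper right entry lies in \<open>(\<pi>\<^sub>x\<^sup>r\<^sup>+\<^sup>1)\<close>, so these matrices
  represent the left cosets of \<open>K\<close> in \<open>K d K\<close>.  For \<open>r = 1\<close> the entry is \<open>a \<pi>\<^sub>x\<close>; for \<open>r \<ge> 2\<close>
  and \<open>a \<noteq> 0\<close>, the matrices with entry \<open>a \<pi>\<^sub>x\<close> do not lie in \<open>K d K\<close>.
\<close>

definition xi_ram :: "('k::field place \<Rightarrow> 'k poly fract) \<Rightarrow> 'k place \<Rightarrow> nat \<Rightarrow> 'k \<Rightarrow>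
    'k alg_closure fls^2^2" where
  "xi_ram \<pi> x r a =
     mat2 (place_embed x (\<pi> x)) (fls_const (to_ac a) * place_embed x (\<pi> x) ^ r) 0 1"

end

theory Submission
  imports Defs
begin

text \<open>
  A Hecke operator that is given by the characteristic function of a double coset \<open>K d K\<close>, divided by the
  volume of \<open>K\<close>, is a finite sum.  If \<open>K d K\<close> is the disjoint union of cosets \<open>\<Xi>\<^sub>1 K, ..., \<Xi>\<^sub>n K\<close>, then an
  automorphic function \<open>f\<close> satisfies \<open>\<Phi>(f)(g) = f(g \<Xi>\<^sub>1) + ... + f(g \<Xi>\<^sub>n)\<close>, because \<open>f(g h)\<close> is constant on
  each coset and left translates of \<open>K\<close> have the same volume (\<open>hecke_action_coset_sum\<close>).  For this the volume
  of \<open>K\<close> has to be positive and finite.  It is at most the volume 1 of the maximal compact subgroup.  The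
  cosets of \<open>K\<close> are open (\<open>openin_coset\<close>), so every compact set is covered by finitely many of them; if
  \<open>K\<close> were a null set, inner regularity would make the Haar measure vanish.

  The multiplicities are the coefficients in such a formula, collected by vertices.  They are unique because
  the indicator function of a vertex is itself automorphic (\<open>multiplicities_eq\<close>).  So the multiplicity of
  a vertex is the number of the \<open>g \<Xi>\<^sub>i\<close> that it contains, and the multiplicities add up to \<open>n\<close>
  (\<open>neighbors_of_coset_representatives\<close>).

  It remains to find representatives, and this is a question about one local component
  (\<open>cosets_at_place\<close>).  With \<open>d = diag(\<pi>, 1)\<close>, a coset in \<open>K d K\<close> is the coset of \<open>l d\<close> for an \<open>l\<close> in the
  local group, and it depends on the second column of \<open>l\<close> only.  Away from the level all points of the
  projective line over the residue field occur, up to scaling, as reductions of this column; the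
  matrices \<open>\<xi>\<close> represent them.  At the level the column is congruent to \<open>(0, 1)\<close> modulo \<open>\<pi>\<^sup>r\<close>, and its upper
  entry modulo \<open>\<pi>\<^sup>r\<^sup>+\<^sup>1\<close> is the remaining parameter, which takes \<open>q\<close> values at a place of degree 1.

  Two facts about the completions enter.  The residue field is finite, with \<open>q\<^sup>d\<close> elements at a place of
  degree \<open>d\<close> (\<open>finite_residue_field\<close>, \<open>card_residue_field\<close>), which gives the numbers of cosets.  And its
  elements, as constant Laurent series, belong to the completion (\<open>residue_field_const_local_int\<close>), so that
  the matrices \<open>\<xi>\<close> are adelic at all.
\<close>

(* The dollar sign is reserved for the entries of matrices. *)
unbundle no Formal_Power_Series.fps_syntax

section \<open>Local fields\<close>

text \<open>
  The powers of the maximal ideal of the local ring; negative exponents give fractional ideals, so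
  that the estimates for products and for inverses take the same form.
\<close>

definition local_ideal :: "'k::field place \<Rightarrow> int \<Rightarrow> 'k alg_closure fls set" where
  "local_ideal z n = {a \<in> local_field z. \<forall>i<n. fls_nth a i = 0}"

lemma local_ideal_0: "local_ideal z 0 = local_int z"
  by (auto simp: local_ideal_def local_int_iff)

lemma zero_local_ideal [simp]: "0 \<in> local_ideal z n"
  by (simp add: local_ideal_def)

lemma local_ideal_add: "a \<in> local_ideal z n \<Longrightarrow> b \<in> local_ideal z n \<Longrightarrow> a + b \<in> local_ideal z n"
  and local_ideal_diff: "a \<in> local_ideal z n \<Longrightarrow> b \<in> local_ideal z n \<Longrightarrow> a - b \<in> local_ideal z n"
  and local_ideal_uminus: "a \<in> local_ideal z n \<Longrightarrow> - a \<in> local_ideal z n"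
  by (auto simp: local_ideal_def local_field_add local_field_diff local_field_uminus)

lemma local_ideal_mult:
  "a \<in> local_ideal z m \<Longrightarrow> b \<in> local_ideal z n \<Longrightarrow> a * b \<in> local_ideal z (m + n)"
  using fls_vanish_mult[of m a n b] by (auto simp: local_ideal_def local_field_mult)

lemma local_ideal_mult_int:
  "a \<in> local_ideal z n \<Longrightarrow> b \<in> local_int z \<Longrightarrow> a * b \<in> local_ideal z n"
  "a \<in> local_int z \<Longrightarrow> b \<in> local_ideal z n \<Longrightarrow> a * b \<in> local_ideal z n"
  using local_ideal_mult[of a z n b 0] local_ideal_mult[of a z 0 b n] by (auto simp: local_ideal_0)

lemma local_ideal_mono: "m \<le> n \<Longrightarrow> a \<in> local_ideal z n \<Longrightarrow> a \<in> local_ideal z m"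
  by (auto simp: local_ideal_def)

lemma local_ideal_int: "0 \<le> n \<Longrightarrow> a \<in> local_ideal z n \<Longrightarrow> a \<in> local_int z"
  using local_ideal_mono local_ideal_0 by blast

lemma local_fieldI_approx:
  assumes "\<And>n. \<exists>b\<in>local_field z. \<forall>i<n. fls_nth b i = fls_nth a i"
  shows "a \<in> local_field z"
  unfolding local_field_iff
proof
  fix n
  obtain b where b: "b \<in> local_field z" "\<forall>i<n. fls_nth b i = fls_nth a i" using assms by blast
  then show "\<exists>f. \<forall>i<n. fls_nth (place_embed z f) i = fls_nth a i"
    unfolding local_field_iff by metis
qed

lemma place_embed_inverse: "place_embed z (inverse f) = inverse (place_embed z f)"
proof (cases "f = 0")
  case False
  then have "place_embed z f * place_embed z (inverse f) = 1"
    by (simp flip: place_embed_mult)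
  then show ?thesis by (metis inverse_unique)
qed simp

text \<open>
  If \<open>f\<close> approximates \<open>a\<close>, then \<open>1/f\<close> approximates \<open>1/a\<close>, because
  \<open>1/f - 1/a = (a - f) / (a f)\<close>; twice the valuation of \<open>a\<close> is lost in precision.
\<close>

lemma local_field_inverse:
  assumes "a \<in> local_field z"
  shows "inverse a \<in> local_field z"
proof (cases "a = 0")
  case False
  show ?thesis
  proof (rule local_fieldI_approx)
    fix n
    define d where "d = fls_subdegree a"
    define N where "N = max (d + 1) (n + 2 * d)"
    obtain f where f: "\<forall>i<N. fls_nth (place_embed z f) i = fls_nth a i"
      using assms unfolding local_field_iff by blast
    let ?b = "place_embed z f"
    have "fls_nth ?b d \<noteq> 0" using False f by (simp add: N_def d_def)
    then have b: "?b \<noteq> 0" by auto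
    have d: "fls_subdegree ?b = d"
      using f False by (intro fls_subdegree_eqI) (auto simp: N_def d_def)
    have 1: "\<forall>i<N. fls_nth (a - ?b) i = 0" using f by simp
    have 2: "\<forall>i < - d. fls_nth (inverse a) i = 0" "\<forall>i < - d. fls_nth (inverse ?b) i = 0"
      using d fls_inverse_subdegree[of a] fls_inverse_subdegree[of ?b] by (auto simp: d_def)
    have "\<forall>i < N + - d + - d. fls_nth ((a - ?b) * inverse a * inverse ?b) i = 0"
      by (intro fls_vanish_mult 1 2)
    moreover have "(a - ?b) * inverse a * inverse ?b = inverse ?b - inverse a"
      using False b by (simp add: field_simps)
    ultimately have "\<forall>i<n. fls_nth (inverse ?b - inverse a) i = 0"
      by (auto simp: N_def)
    then show "\<exists>b\<in>local_field z. \<forall>i<n. fls_nth b i = fls_nth (inverse a) i"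
      by (intro bexI[of _ "inverse ?b"]) (auto simp flip: place_embed_inverse)
  qed
qed simp

lemma local_ideal_inverse:
  assumes "a \<in> local_field z" "fls_subdegree a \<le> n" "a \<noteq> 0"
  shows "inverse a \<in> local_ideal z (- n)"
  using assms fls_inverse_subdegree[of a] by (auto simp: local_ideal_def local_field_inverse)

lemma local_int_inverse:
  assumes "a \<in> local_int z" "fls_nth a 0 \<noteq> 0"
  shows "inverse a \<in> local_int z"
proof -
  have "fls_subdegree a \<le> 0" using assms(2) by (rule fls_subdegree_leI)
  moreover have "a \<noteq> 0" using assms(2) by auto
  ultimately show ?thesis
    using local_ideal_inverse[of a z 0] assms(1) by (simp add: local_ideal_0 local_int_def)
qed

text \<open>
  A uniformizer of the function field has valuation 1 for the parameter of the ambient field of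
  Laurent series, and division by it stays inside the completion, which is a field.  Hence it plays the
  role of that parameter.
\<close>

lemma local_ideal_uniformizer:
  assumes "uniformizer z f"
  shows "place_embed z f ^ n * a \<in> local_ideal z (int n + m) \<longleftrightarrow> a \<in> local_ideal z m"
proof -
  let ?t = "place_embed z f"
  have t: "?t \<noteq> 0" "fls_subdegree ?t = 1" using assms by (auto simp: uniformizer_def)
  have tn: "fls_subdegree (?t ^ n) = int n" using t by (simp add: fls_subdegree_pow)
  have F: "?t ^ n \<in> local_field z"
    by (induction n) (auto intro: local_field_mult)
  have "?t ^ n \<in> local_ideal z (int n)" using F tn by (auto simp: local_ideal_def)
  moreover have "inverse (?t ^ n) \<in> local_ideal z (- int n)"
    using F t tn by (intro local_ideal_inverse) auto
  ultimately show ?thesis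
    using local_ideal_mult[of "?t ^ n" z "int n" a m]
      local_ideal_mult[of "inverse (?t ^ n)" z "- int n" "?t ^ n * a" "int n + m"] t(1)
    by (auto simp: field_simps)
qed

lemma local_ideal_eq_uniformizer_mult:
  assumes "uniformizer z f"
  shows "a \<in> local_ideal z (int n) \<longleftrightarrow> (\<exists>c\<in>local_int z. a = place_embed z f ^ n * c)"
proof
  assume a: "a \<in> local_ideal z (int n)"
  have t: "place_embed z f \<noteq> 0" using assms by (auto simp: uniformizer_def)
  define c where "c = a / place_embed z f ^ n"
  have "a = place_embed z f ^ n * c" using t by (simp add: c_def)
  moreover from this have "c \<in> local_int z"
    using a local_ideal_uniformizer[OF assms, of n c 0] by (simp add: local_ideal_0)
  ultimately show "\<exists>c\<in>local_int z. a = place_embed z f ^ n * c" by blast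
next
  assume "\<exists>c\<in>local_int z. a = place_embed z f ^ n * c"
  then show "a \<in> local_ideal z (int n)"
    using local_ideal_uniformizer[OF assms, of n _ 0] by (auto simp: local_ideal_0)
qed

section \<open>Residue fields\<close>

lemma local_int_const: "fls_const (to_ac c) \<in> local_int z"
proof -
  have "place_embed z (Fract [:c:] 1) = fls_const (to_ac c)"
    by (simp add: place_embed_Fract expand_pCons)
  then have "fls_const (to_ac c) \<in> local_field z" by (metis place_embed_local_field)
  then show ?thesis by (simp add: local_int_iff)
qed

lemma fls_nth_0_mult_integral:
  fixes a b :: "'a::field fls"
  assumes "\<forall>i<0. fls_nth a i = 0" "\<forall>i<0. fls_nth b i = 0"
  shows "fls_nth (a * b) 0 = fls_nth a 0 * fls_nth b 0"
proof -
  let ?a = "a - fls_const (fls_nth a 0)" and ?b = "b - fls_const (fls_nth b 0)"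
  have *: "\<forall>i<1. fls_nth (c - fls_const (fls_nth c 0)) i = 0" if "\<forall>i<0. fls_nth c i = 0" for c :: "'a fls"
    using that by (auto simp: not_less zless_add1_eq[of _ 0, simplified])
  have "\<forall>i<1 + 0. fls_nth (?a * b) i = 0"
    by (intro fls_vanish_mult *[OF assms(1)] assms(2))
  moreover have "a * b = ?a * b + fls_const (fls_nth a 0) * b" by (simp add: algebra_simps)
  ultimately show ?thesis by simp
qed

lemma residue_field_closed:
  shows residue_field_0: "0 \<in> residue_field z"
    and residue_field_add: "a \<in> residue_field z \<Longrightarrow> b \<in> residue_field z \<Longrightarrow> a + b \<in> residue_field z"
    and residue_field_mult: "a \<in> residue_field z \<Longrightarrow> b \<in> residue_field z \<Longrightarrow> a * b \<in> residue_field z"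
    and residue_field_to_ac: "to_ac c \<in> residue_field z"
proof -
  show "0 \<in> residue_field z" unfolding residue_field_def by (rule image_eqI[of _ _ 0]) auto
  show "to_ac c \<in> residue_field z"
    unfolding residue_field_def by (rule image_eqI[OF _ local_int_const[of c]]) simp
  assume "a \<in> residue_field z" "b \<in> residue_field z"
  then obtain a' b' where ab: "a' \<in> local_int z" "b' \<in> local_int z" "a = fls_nth a' 0" "b = fls_nth b' 0"
    by (auto simp: residue_field_def)
  show "a + b \<in> residue_field z"
    unfolding residue_field_def using ab by (intro image_eqI[of _ _ "a' + b'"]) (auto intro: local_int_add)
  show "a * b \<in> residue_field z"
    unfolding residue_field_def
  proof (rule image_eqI)
    show "a' * b' \<in> local_int z" using ab by (intro local_int_mult)
    show "a * b = fls_nth (a' * b') 0"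
      using ab by (simp add: fls_nth_0_mult_integral local_int_iff)
  qed
qed

text \<open>
  By density, every residue is the residue of a rational function, hence zero or the quotient of the
  leading coefficients of the expansions of two polynomials.  All coefficients of such expansions lie in
  the ring \<open>E\<close> generated over the constants by the root of the place (at infinity, in
  the constants).  This ring is finite: the root is
  algebraic, so its elements are polynomials of bounded degree in the root.
\<close>

lemma finite_residue_field:
  fixes z :: "'k::finite_field place"
  shows "finite (residue_field z)"
proof -
  define \<alpha> where "\<alpha> = place_root z"
  define E where "E = range (\<lambda>b :: 'k poly. poly (map_poly to_ac b) \<alpha>)"
  obtain p :: "'k poly" where p: "p \<noteq> 0" "poly (map_poly to_ac p) \<alpha> = 0"
    by (rule alg_closure_algebraic)
  have "E \<subseteq> (\<lambda>b. poly (map_poly to_ac b) \<alpha>) ` {b. degree b \<le> degree p}"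
  proof -
    have "poly (map_poly to_ac b) \<alpha> = poly (map_poly to_ac (b mod p)) \<alpha>" for b
    proof -
      have "map_poly to_ac b = map_poly to_ac (b div p * p + b mod p)" by simp
      then show ?thesis using p(2) unfolding map_poly_to_ac_add map_poly_to_ac_mult by simp
    qed
    moreover have "degree (b mod p) \<le> degree p" for b
      using degree_mod_less[OF p(1), of b] by auto
    ultimately show ?thesis unfolding E_def by blast
  qed
  then have E: "finite E" using finite_degree_le finite_subset by blast
  have E_add: "u + v \<in> E" if "u \<in> E" "v \<in> E" for u v
    using that unfolding E_def by (auto simp flip: poly_add map_poly_to_ac_add)
  have E_mult: "u * v \<in> E" if "u \<in> E" "v \<in> E" for u v
    using that unfolding E_def by (auto simp flip: poly_mult map_poly_to_ac_mult)
  have E_const: "to_ac c \<in> E" for c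
    unfolding E_def by (rule range_eqI[of _ _ "[:c:]"]) (simp add: map_poly_pCons)
  have E_\<alpha>: "\<alpha> \<in> E"
    unfolding E_def by (rule range_eqI[of _ _ "[:0, 1:]"]) (simp add: map_poly_pCons)
  have E_0: "0 \<in> E" using E_const[of 0] by simp
  have nth: "fls_nth (expand z a) i \<in> E" for a i
  proof (induction a arbitrary: i)
    case (pCons c a)
    have c: "fls_nth (fls_const (to_ac c)) i \<in> E" by (simp add: E_const E_0)
    show ?case
    proof (cases "poly_of_place z")
      case None
      then show ?thesis using pCons c
        by (auto simp: expand_pCons place_coord_def fls_X_inv_times_conv_shift intro!: E_add E_const)
    next
      case (Some q)
      then have "place_coord z = fls_const \<alpha> + fls_X" by (simp add: place_coord_def \<alpha>_def)
      then show ?thesis using pCons c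
        by (auto simp: expand_pCons algebra_simps fls_X_times_conv_shift intro!: E_add E_const E_mult E_\<alpha>)
    qed
  qed (simp add: E_0)
  have "residue_field z \<subseteq> insert 0 ((\<lambda>(u, v). u / v) ` (E \<times> E))"
  proof
    fix c assume "c \<in> residue_field z"
    then obtain h where h: "h \<in> local_int z" "c = fls_nth h 0" by (auto simp: residue_field_def)
    then obtain f where f: "\<forall>i<1. fls_nth (place_embed z f) i = fls_nth h i"
      unfolding local_int_iff local_field_iff by blast
    obtain a b where ab: "f = Fract a b" "b \<noteq> 0" by (cases f)
    have c: "c = fls_nth (expand z a / expand z b) 0"
      using f h ab by (simp add: place_embed_Fract)
    show "c \<in> insert 0 ((\<lambda>(u, v). u / v) ` (E \<times> E))"
    proof (cases "c = 0")
      case False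
      then have a: "expand z a \<noteq> 0" using c by auto
      have b: "expand z b \<noteq> 0" using ab expand_nonzero by blast
      have q: "expand z a / expand z b \<noteq> 0" using a b by simp
      have "\<forall>i<0. fls_nth (expand z a / expand z b) i = 0"
        using f h ab by (simp add: place_embed_Fract local_int_iff)
      then have "fls_subdegree (expand z a / expand z b) = 0"
        using c False by (intro fls_subdegree_eqI) auto
      moreover from this have "fls_subdegree (expand z a) = fls_subdegree (expand z b)"
        using a b fls_divide_subdegree[OF a b] by simp
      ultimately have "c = fls_nth (expand z a) (fls_subdegree (expand z a)) /
          fls_nth (expand z b) (fls_subdegree (expand z b))"
        using c fls_divide_nth_base[of "expand z a" "expand z b"] a b by simp
      then show ?thesis using nth by (intro insertI2 image_eqI[of _ _ "(_, _)"]) auto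
    qed simp
  qed
  then show ?thesis using E by (meson finite_SigmaI finite_imageI finite_insert finite_subset)
qed

text \<open>
  The constants of the residue field belong to the completion: a power of Frobenius fixes the
  constant \<open>c\<close>, and by iterating it on a lift \<open>c + h\<close> one obtains \<open>c + h\<^bsup>Q\<^esup>\<close> with arbitrarily
  large \<open>Q\<close>, which tends to \<open>c\<close>.  The constant is fixed because its Frobenius orbit stays in the
  finite residue field and Frobenius is injective.
\<close>

lemma residue_field_const_local_int:
  fixes z :: "'k::finite_field place"
  assumes c: "c \<in> residue_field z"
  shows "fls_const c \<in> local_int z"
proof -
  define p where "p = CHAR('k)"
  have p: "Factorial_Ring.prime p" "CHAR('k alg_closure) = p" "CHAR('k alg_closure fls) = p"
    unfolding p_def by (auto intro!: prime_CHAR_semidom CHAR_pos simp: CHAR_pos_iff)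
  have p2: "p \<ge> 2" using p(1) prime_ge_2_nat by blast
  have pow: "c ^ Suc n \<in> residue_field z" for n
    by (induction n) (use c in \<open>auto intro: residue_field_mult\<close>)
  have "c ^ (p ^ i) \<in> residue_field z" for i
  proof -
    have "p ^ i > 0" using p2 by simp
    then show ?thesis using pow[of "p ^ i - 1"] by simp
  qed
  then have "\<not> inj (\<lambda>i::nat. c ^ (p ^ i))"
    using finite_residue_field[of z] by (meson finite_subset image_subsetI range_inj_infinite)
  then obtain i j :: nat where ij: "i < j" "c ^ (p ^ i) = c ^ (p ^ j)"
    unfolding inj_def by (metis nat_neq_iff)
  define m where "m = j - i"
  have m: "m > 0" "j = m + i" using ij(1) by (auto simp: m_def)
  have "((c ^ (p ^ m) - c) + c) ^ (p ^ i) = (c ^ (p ^ m) - c) ^ (p ^ i) + c ^ (p ^ i)"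
    using p by (intro freshmans_dream') auto
  then have "(c ^ (p ^ m) - c) ^ (p ^ i) = 0"
    using ij(2) by (simp add: m(2) power_add power_mult)
  then have fix1: "c ^ (p ^ m) = c" by simp
  have fixn: "c ^ (p ^ (m * n)) = c" for n
    by (induction n) (simp_all add: power_add power_mult fix1)
  obtain h where h: "h \<in> local_int z" "c = fls_nth h 0" using c by (auto simp: residue_field_def)
  have "fls_const c \<in> local_field z"
  proof (rule local_fieldI_approx)
    fix n
    define N where "N = p ^ (m * nat n)"
    have hN: "h ^ k \<in> local_field z" for k
      by (induction k) (use h in \<open>auto intro: local_field_mult simp: local_int_iff\<close>)
    have vanish: "\<forall>i<int k. fls_nth ((h - fls_const c) ^ k) i = 0" for k
    proof (induction k)
      case (Suc k)
      have "\<forall>i<1. fls_nth (h - fls_const c) i = 0"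
        using h by (auto simp: local_int_iff zless_add1_eq[of _ 0, simplified])
      then show ?case using fls_vanish_mult[of 1 "h - fls_const c" "int k"] Suc by simp
    qed simp
    have "n \<le> int N"
    proof -
      have "nat n \<le> m * nat n" using m(1) by simp
      also have "\<dots> < 2 ^ (m * nat n)" by (rule less_exp)
      also have "\<dots> \<le> N" unfolding N_def using p2 by (intro power_mono) auto
      finally show ?thesis by linarith
    qed
    have "(h - fls_const c + fls_const c) ^ N = (h - fls_const c) ^ N + fls_const c ^ N"
      using p unfolding N_def by (intro freshmans_dream') auto
    moreover have "fls_const c ^ N = fls_const (c ^ N)" by (simp add: fls_const_power)
    ultimately have "h ^ N = (h - fls_const c) ^ N + fls_const c" by (simp add: N_def fixn)
    then have "\<forall>i<n. fls_nth (h ^ N) i = fls_nth (fls_const c) i"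
      using vanish[of N] \<open>n \<le> int N\<close> by simp
    then show "\<exists>b\<in>local_field z. \<forall>i<n. fls_nth b i = fls_nth (fls_const c) i" using hN by blast
  qed
  then show ?thesis by (simp add: local_int_iff)
qed

lemma card_residue_field:
  fixes z :: "'k::finite_field place"
  shows "card (residue_field z) = CARD('k) ^ place_degree z"
proof -
  let ?s = "\<lambda>(c::'k) (v::'k alg_closure). to_ac c * v"
  interpret vs: vector_space ?s
    by unfold_locales (simp_all add: algebra_simps)
  have card_span: "card (vs.span B) = CARD('k) ^ card B" if "finite B" "vs.independent B" for B
    using that
  proof (induction B)
    case empty
    then show ?case by simp
  next
    case (insert b B)
    then have ind: "vs.independent B" "b \<notin> vs.span B"
      using vs.independent_insert[of b B] by auto
    have "bij_betw (\<lambda>(c, v). ?s c b + v) (UNIV \<times> vs.span B) (vs.span (insert b B))"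
      unfolding bij_betw_def
    proof
      show "inj_on (\<lambda>(c, v). ?s c b + v) (UNIV \<times> vs.span B)"
      proof (rule inj_onI, clarify)
        fix c v c' v' assume v: "v \<in> vs.span B" "v' \<in> vs.span B" "?s c b + v = ?s c' b + v'"
        have "c = c'"
        proof (rule ccontr)
          assume "c \<noteq> c'"
          have "?s (c - c') b = v' - v" using v(3) by (simp add: algebra_simps)
          then have "?s (c - c') b \<in> vs.span B" using v vs.span_diff by simp
          then have "?s (inverse (c - c')) (?s (c - c') b) \<in> vs.span B" by (rule vs.span_scale)
          moreover have "?s (inverse (c - c')) (?s (c - c') b) = b"
            using \<open>c \<noteq> c'\<close> by (simp flip: mult.assoc to_ac_mult)
          ultimately show False using ind(2) by metis
        qed
        then show "c = c' \<and> v = v'" using v(3) by simp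
      qed
      show "(\<lambda>(c, v). ?s c b + v) ` (UNIV \<times> vs.span B) = vs.span (insert b B)"
        unfolding vs.span_insert
      proof (intro equalityI subsetI)
        fix u assume "u \<in> {u. \<exists>c. u - ?s c b \<in> vs.span B}"
        then obtain c where "u - ?s c b \<in> vs.span B" by blast
        then show "u \<in> (\<lambda>(c, v). ?s c b + v) ` (UNIV \<times> vs.span B)"
          by (intro image_eqI[of _ _ "(c, u - ?s c b)"]) auto
      next
        fix u assume "u \<in> (\<lambda>(c, v). ?s c b + v) ` (UNIV \<times> vs.span B)"
        then obtain c v where "u = ?s c b + v" "v \<in> vs.span B" by auto
        then show "u \<in> {u. \<exists>c. u - ?s c b \<in> vs.span B}" by (intro CollectI exI[of _ c]) simp
      qed
    qed
    from bij_betw_same_card[OF this] have "card (vs.span (insert b B)) = CARD('k) * card (vs.span B)"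
      unfolding card_cartesian_product by (rule sym)
    then show ?case using insert ind by simp
  qed
  have sub: "vs.subspace (residue_field z)"
    unfolding vs.subspace_def using residue_field_closed by blast
  obtain B where B: "B \<subseteq> residue_field z" "vs.independent B" "residue_field z \<subseteq> vs.span B"
    "card B = vs.dim (residue_field z)"
    by (rule vs.basis_exists)
  have "finite B" using B(1) finite_residue_field finite_subset by blast
  moreover have "vs.span B = residue_field z"
    using B sub vs.span_minimal by blast
  ultimately show ?thesis using card_span[of B] B(2,4) unfolding place_degree_def by metis
qed

text \<open>
  At a place of degree 1 the representatives at the level may be indexed by the constants: both sets
  have \<open>q\<close> elements.
\<close>

lemma residue_field_degree_1:
  fixes z :: "'k::finite_field place"
  assumes "place_degree z = 1"
  shows "residue_field z = range to_ac"
proof -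
  have "card (range to_ac :: 'k alg_closure set) = CARD('k)" by (simp add: card_image inj_to_ac)
  then show ?thesis
    using card_subset_eq[of "residue_field z" "range to_ac"] residue_field_to_ac[of _ z]
      card_residue_field[of z] assms finite_residue_field[of z]
    by (metis image_subsetI power_one_right)
qed

lemma residue_field_lift:
  assumes "a \<in> local_int z"
  shows "fls_nth a 0 \<in> residue_field z"
  using assms by (simp add: residue_field_def)

lemma local_ideal_1_iff: "a \<in> local_int z \<Longrightarrow> a \<in> local_ideal z 1 \<longleftrightarrow> fls_nth a 0 = 0"
  by (auto simp: local_int_iff local_ideal_def zless_add1_eq[of _ 0, simplified])

section \<open>Two-by-two matrices\<close>

lemma mat2_nth [simp]:
  "mat2 a b c d $ 1 $ 1 = a" "mat2 a b c d $ 1 $ 2 = b" "mat2 a b c d $ 2 $ 1 = c" "mat2 a b c d $ 2 $ 2 = d"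
  by (simp_all add: mat2_def)

lemma mat2_eqI:
  fixes g h :: "'a^2^2"
  assumes "g $ 1 $ 1 = h $ 1 $ 1" "g $ 1 $ 2 = h $ 1 $ 2" "g $ 2 $ 1 = h $ 2 $ 1" "g $ 2 $ 2 = h $ 2 $ 2"
  shows "g = h"
  using assms by (simp add: vec_eq_iff forall_2)

lemma mat2_exhaust:
  fixes g :: "('a::zero)^2^2"
  obtains a b c d where "g = mat2 a b c d"
  using mat2_eqI[of g "mat2 (g $ 1 $ 1) (g $ 1 $ 2) (g $ 2 $ 1) (g $ 2 $ 2)"] by auto

lemma mat2_mult:
  "mat2 a b c d ** mat2 a' b' c' d' =
     mat2 (a * a' + b * c') (a * b' + b * d') (c * a' + d * c') (c * b' + (d::'a::semiring_1) * d')"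
  by (rule mat2_eqI) (simp_all add: matrix_matrix_mult_def sum_2)

lemma mat2_one: "mat 1 = mat2 1 0 0 (1::'a::zero_neq_one)"
  by (rule mat2_eqI) (simp_all add: mat_def)

lemma mat2_eq_iff [simp]: "mat2 a b c d = mat2 a' b' c' d' \<longleftrightarrow> a = a' \<and> b = b' \<and> c = c' \<and> d = d'"
  (is "?l = ?r \<longleftrightarrow> ?P")
proof
  assume e: "?l = ?r"
  have "?l $ i $ j = ?r $ i $ j" for i j by (simp only: e)
  from this[of 1 1] this[of 1 2] this[of 2 1] this[of 2 2] show ?P by simp
qed simp

lemma matrix_inv_eq:
  fixes g h :: "'a::semiring_1^'n^'n"
  assumes "g ** h = mat 1" "h ** g = mat 1"
  shows "matrix_inv g = h"
proof -
  have "g ** matrix_inv g = mat 1 \<and> matrix_inv g ** g = mat 1"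
    unfolding matrix_inv_def by (rule someI[of _ h]) (intro conjI assms)
  then have "matrix_inv g = h ** g ** matrix_inv g" "h ** (g ** matrix_inv g) = h"
    by (simp_all only: assms matrix_mul_lid matrix_mul_rid)
  then show ?thesis by (simp only: matrix_mul_assoc)
qed

lemma GL2_I:
  assumes "\<forall>i j. g $ i $ j \<in> R" "\<forall>i j. h $ i $ j \<in> R" "g ** h = mat 1" "h ** g = mat 1"
  shows "g \<in> GL2 R"
  unfolding GL2_def using assms by (intro CollectI conjI exI[of _ h])

lemma GL2_entry: "g \<in> GL2 R \<Longrightarrow> g $ i $ j \<in> R"
  by (simp add: GL2_def)

lemma GL2_E:
  assumes "g \<in> GL2 R"
  obtains h where "\<forall>i j. g $ i $ j \<in> R" "\<forall>i j. h $ i $ j \<in> R" "g ** h = mat 1" "h ** g = mat 1"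
proof -
  have "(\<forall>i j. g $ i $ j \<in> R) \<and> (\<exists>h. (\<forall>i j. h $ i $ j \<in> R) \<and> g ** h = mat 1 \<and> h ** g = mat 1)"
    using assms unfolding GL2_def by (rule CollectD)
  then show thesis by (elim conjE exE) (rule that)
qed

lemma GL2_inverse:
  fixes g :: "'a::comm_ring_1^2^2"
  assumes "g \<in> GL2 R"
  shows "matrix_inv g \<in> GL2 R" "g ** matrix_inv g = mat 1" "matrix_inv g ** g = mat 1"
proof -
  obtain h where h: "\<forall>i j. g $ i $ j \<in> R" "\<forall>i j. h $ i $ j \<in> R" "g ** h = mat 1" "h ** g = mat 1"
    using assms by (rule GL2_E)
  have i: "matrix_inv g = h" using h(3,4) by (rule matrix_inv_eq)
  show "matrix_inv g \<in> GL2 R" unfolding i by (rule GL2_I[OF h(2,1,4,3)])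
  show "g ** matrix_inv g = mat 1" "matrix_inv g ** g = mat 1" unfolding i by (rule h(3), rule h(4))
qed

lemma GL2_mult:
  fixes g h :: "'a::comm_ring_1^2^2"
  assumes R: "\<And>a b. a \<in> R \<Longrightarrow> b \<in> R \<Longrightarrow> a + b \<in> R" "\<And>a b. a \<in> R \<Longrightarrow> b \<in> R \<Longrightarrow> a * b \<in> R"
    and g: "g \<in> GL2 R" and h: "h \<in> GL2 R"
  shows "g ** h \<in> GL2 R"
proof -
  have entries: "\<forall>i j. (A ** B) $ i $ j \<in> R" if "A \<in> GL2 R" "B \<in> GL2 R" for A B :: "'a^2^2"
    unfolding matrix_matrix_mult_def
    by (simp add: sum_2) (intro allI R GL2_entry that)
  let ?g = "matrix_inv g" and ?h = "matrix_inv h"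
  have "(g ** h) ** (?h ** ?g) = g ** (h ** ?h) ** ?g" by (simp only: matrix_mul_assoc)
  then have 1: "(g ** h) ** (?h ** ?g) = mat 1"
    by (simp only: GL2_inverse[OF g] GL2_inverse[OF h] matrix_mul_rid)
  have "(?h ** ?g) ** (g ** h) = ?h ** (?g ** g) ** h" by (simp only: matrix_mul_assoc)
  then have 2: "(?h ** ?g) ** (g ** h) = mat 1"
    by (simp only: GL2_inverse[OF g] GL2_inverse[OF h] matrix_mul_rid)
  show ?thesis
    by (rule GL2_I[OF entries[OF g h] entries[OF GL2_inverse(1)[OF h] GL2_inverse(1)[OF g]] 1 2])
qed

lemma GL2_UNIV_mult: "g \<in> GL2 UNIV \<Longrightarrow> h \<in> GL2 UNIV \<Longrightarrow> g ** h \<in> GL2 UNIV"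
  by (rule GL2_mult) auto

lemma GL2_one: "0 \<in> R \<Longrightarrow> 1 \<in> R \<Longrightarrow> mat 1 \<in> GL2 (R :: 'a::comm_ring_1 set)"
  by (rule GL2_I[of _ _ "mat 1"]) (simp_all, simp_all add: mat_def)

lemma GL2_mat2_I:
  fixes a b c d u :: "'a::comm_ring_1"
  assumes R: "\<And>a b. a \<in> R \<Longrightarrow> b \<in> R \<Longrightarrow> a * b \<in> R" "\<And>a. a \<in> R \<Longrightarrow> - a \<in> R"
    and "a \<in> R" "b \<in> R" "c \<in> R" "d \<in> R" "u \<in> R" "(a * d - b * c) * u = 1"
  shows "mat2 a b c d \<in> GL2 R"
proof -
  let ?h = "mat2 (u * d) (- (u * b)) (- (u * c)) (u * a)"
  have "mat2 a b c d ** ?h = mat 1" "?h ** mat2 a b c d = mat 1"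
    using assms(8) by (auto simp: mat2_mult mat2_one algebra_simps)
  moreover have "\<forall>i j. mat2 a b c d $ i $ j \<in> R" "\<forall>i j. ?h $ i $ j \<in> R"
    using assms by (simp_all add: forall_2)
  ultimately show ?thesis by (intro GL2_I[of _ _ ?h])
qed

lemma GL2_mat2_D:
  fixes a b c d :: "'a::comm_ring_1"
  assumes R: "\<And>a b. a \<in> R \<Longrightarrow> b \<in> R \<Longrightarrow> a * b \<in> R" "\<And>a b. a \<in> R \<Longrightarrow> b \<in> R \<Longrightarrow> a - b \<in> R"
    and "mat2 a b c d \<in> GL2 R"
  shows "a \<in> R \<and> b \<in> R \<and> c \<in> R \<and> d \<in> R \<and> (\<exists>u\<in>R. (a * d - b * c) * u = 1)"
proof -
  obtain h where h: "\<forall>i j. mat2 a b c d $ i $ j \<in> R" "mat2 a b c d ** h = mat 1" "\<forall>i j. h $ i $ j \<in> R"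
    using assms(3) by (rule GL2_E)
  obtain a' b' c' d' where h': "h = mat2 a' b' c' d'" by (rule mat2_exhaust)
  have "det (mat2 a b c d) * det h = 1"
    using h(2) by (metis det_I det_mul)
  then have "(a * d - b * c) * (a' * d' - b' * c') = 1" by (simp add: h' det_2)
  moreover have "a' * d' - b' * c' \<in> R" using R h(3) by (simp add: h' forall_2)
  ultimately show ?thesis using h(1) by (auto simp: forall_2)
qed

lemma GL2_local_int_iff:
  "mat2 a b c d \<in> GL2 (local_int z) \<longleftrightarrow>
     a \<in> local_int z \<and> b \<in> local_int z \<and> c \<in> local_int z \<and> d \<in> local_int z \<and> fls_nth (a * d - b * c) 0 \<noteq> 0"
proof
  assume "mat2 a b c d \<in> GL2 (local_int z)"
  from GL2_mat2_D[OF local_int_mult local_int_diff this]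
  obtain u where *: "a \<in> local_int z" "b \<in> local_int z" "c \<in> local_int z" "d \<in> local_int z"
    "u \<in> local_int z" "(a * d - b * c) * u = 1" by blast
  have "a * d - b * c \<in> local_int z" using * by (intro local_int_diff local_int_mult)
  then have "fls_nth (a * d - b * c) 0 * fls_nth u 0 = 1"
    using fls_nth_0_mult_integral[of "a * d - b * c" u] * by (simp add: local_int_iff)
  then show "a \<in> local_int z \<and> b \<in> local_int z \<and> c \<in> local_int z \<and> d \<in> local_int z \<and>
      fls_nth (a * d - b * c) 0 \<noteq> 0"
    using * by auto
next
  assume *: "a \<in> local_int z \<and> b \<in> local_int z \<and> c \<in> local_int z \<and> d \<in> local_int z \<and>
      fls_nth (a * d - b * c) 0 \<noteq> 0"
  have "a * d - b * c \<in> local_int z" using * by (intro local_int_diff local_int_mult) auto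
  then have "inverse (a * d - b * c) \<in> local_int z" using * by (intro local_int_inverse) auto
  moreover have "a * d - b * c \<noteq> 0" using * by auto
  ultimately show "mat2 a b c d \<in> GL2 (local_int z)"
    using * by (intro GL2_mat2_I[where u = "inverse (a * d - b * c)"] local_int_mult local_int_uminus) auto
qed

section \<open>Adelic matrices and their components\<close>

lemma adele_nth_simps [simp]:
  "adele_nth 0 z = 0" "adele_nth 1 z = 1" "adele_nth (a + b) z = adele_nth a z + adele_nth b z"
  "adele_nth (a - b) z = adele_nth a z - adele_nth b z" "adele_nth (- a) z = - adele_nth a z"
  "adele_nth (a * b) z = adele_nth a z * adele_nth b z"
  by (simp_all add: zero_adele.rep_eq one_adele.rep_eq plus_adele.rep_eq minus_adele.rep_eq
      uminus_adele.rep_eq times_adele.rep_eq)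

lemma adele_eqI: "(\<And>z. adele_nth a z = adele_nth b z) \<Longrightarrow> a = b"
  by (metis adele_nth_inject ext)

lemma component_nth [simp]: "component z g $ i $ j = adele_nth (g $ i $ j) z"
  by (simp add: component_def map_matrix_def)

lemma component_mult: "component z (g ** h) = component z g ** component z h"
  by (rule mat2_eqI) (simp_all add: matrix_matrix_mult_def sum_2)

lemma component_one [simp]: "component z (mat 1) = mat 1"
  by (rule mat2_eqI) (simp_all add: mat_def)

lemma component_eqI: "(\<And>z. component z g = component z h) \<Longrightarrow> g = h"
  by (metis component_nth adele_eqI mat2_eqI)

lemma adele_nth_local_field [simp]: "adele_nth a z \<in> local_field z"
  using adele_nth by blast

definition glue :: "('k::field place \<Rightarrow> 'k alg_closure fls^2^2) \<Rightarrow> 'k adele^2^2" where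
  "glue h = (\<chi> i j. Abs_adele (\<lambda>z. h z $ i $ j))"

lemma component_glue:
  fixes h :: "'k::field place \<Rightarrow> 'k alg_closure fls^2^2"
  assumes "\<And>z i j. h z $ i $ j \<in> local_field z"
    and "finite S" "\<And>z i j. z \<notin> S \<Longrightarrow> h z $ i $ j \<in> local_int z"
  shows "component z (glue h) = h z"
proof -
  have "adele_nth (Abs_adele (\<lambda>z. h z $ i $ j)) z = h z $ i $ j" for i j
  proof -
    have "finite {z. h z $ i $ j \<notin> local_int z}"
      using assms(2,3) by (metis (mono_tags, lifting) finite_subset mem_Collect_eq subsetI)
    then show ?thesis using assms(1) by (subst Abs_adele_inverse) auto
  qed
  then show ?thesis by (intro mat2_eqI) (simp_all add: glue_def)
qed

lemma component_at_place:
  assumes "\<And>i j. h $ i $ j \<in> local_field z"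
  shows "component w (at_place z h) = (if w = z then h else mat 1)"
proof -
  let ?h = "\<lambda>w. if w = z then h else mat 1"
  have "at_place z h = glue ?h"
    by (simp add: at_place_def glue_def if_distrib[where f = "\<lambda>x. x $ _ $ _"] cong: if_cong)
  moreover have "component w (glue ?h) = ?h w"
    using assms by (intro component_glue[of _ "{z}"]) (auto simp: mat_def)
  ultimately show ?thesis by simp
qed

lemma at_place_mult:
  assumes "\<And>i j. h $ i $ j \<in> local_field z" "\<And>i j. h' $ i $ j \<in> local_field z"
  shows "at_place z (h ** h') = at_place z h ** at_place z h'"
proof (rule component_eqI)
  fix w
  have "(h ** h') $ i $ j \<in> local_field z" for i j
    using assms by (simp add: matrix_matrix_mult_def sum_2 local_field_add local_field_mult)
  then show "component w (at_place z (h ** h')) = component w (at_place z h ** at_place z h')"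
    using assms by (simp add: component_mult component_at_place)
qed

lemma at_place_one: "at_place z (mat 1) = mat 1"
proof (rule component_eqI)
  fix w
  have "mat 1 $ i $ j \<in> local_field z" for i j :: 2 by (simp add: mat_def)
  then show "component w (at_place z (mat 1)) = component w (mat 1)"
    by (simp add: component_at_place)
qed

lemma at_place_GL2:
  assumes "h \<in> GL2 (local_field z)"
  shows "at_place z h \<in> GL2_adele"
proof -
  have 1: "\<And>i j. h $ i $ j \<in> local_field z" "\<And>i j. matrix_inv h $ i $ j \<in> local_field z"
    using assms GL2_inverse(1)[OF assms] by (auto intro: GL2_entry)
  have "at_place z h ** at_place z (matrix_inv h) = mat 1" "at_place z (matrix_inv h) ** at_place z h = mat 1"
    by (simp_all flip: at_place_mult add: 1 GL2_inverse[OF assms] at_place_one)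
  then show ?thesis by (intro GL2_I) auto
qed

lemma GL2_local_field_I:
  assumes "a \<in> local_field z" "b \<in> local_field z" "c \<in> local_field z" "d \<in> local_field z" "a * d - b * c \<noteq> 0"
  shows "mat2 a b c d \<in> GL2 (local_field z)"
  using assms
  by (intro GL2_mat2_I[where u = "inverse (a * d - b * c)"])
     (auto intro!: local_field_mult local_field_uminus local_field_inverse local_field_diff)

section \<open>The level group\<close>

text \<open>
  The factor of the level group at the place \<open>z\<close>.
\<close>

definition local_level :: "'k::field place \<Rightarrow> nat \<Rightarrow> 'k place \<Rightarrow> ('k alg_closure fls^2^2) set" where
  "local_level x r z =
     {h \<in> GL2 (local_int z). z = x \<longrightarrow> (\<forall>i j. h $ i $ j - mat 1 $ i $ j \<in> local_ideal x (int r))}"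

lemma local_level_unramified: "z \<noteq> x \<Longrightarrow> local_level x r z = GL2 (local_int z)"
  by (simp add: local_level_def)

lemma local_level_mult:
  assumes "g \<in> local_level x r z" "h \<in> local_level x r z"
  shows "g ** h \<in> local_level x r z"
proof -
  have "(g ** h) $ i $ j - mat 1 $ i $ j \<in> local_ideal x (int r)" if z: "z = x" for i j
  proof -
    have "(g ** h) $ i $ j - mat 1 $ i $ j =
      (\<Sum>k\<in>UNIV. (g $ i $ k - mat 1 $ i $ k) * h $ k $ j) + (h $ i $ j - mat 1 $ i $ j)"
      using exhaust_2[of i] by (auto simp: matrix_matrix_mult_def sum_2 mat_def algebra_simps)
    moreover have "(g $ i $ k - mat 1 $ i $ k) * h $ k $ j \<in> local_ideal x (int r)" for k
      using assms z by (intro local_ideal_mult_int) (auto simp: local_level_def GL2_entry)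
    moreover have "h $ i $ j - mat 1 $ i $ j \<in> local_ideal x (int r)"
      using assms z by (simp add: local_level_def)
    ultimately show ?thesis by (simp only: sum_2 local_ideal_add)
  qed
  moreover have "g ** h \<in> GL2 (local_int z)"
    using assms by (intro GL2_mult local_int_add local_int_mult) (auto simp: local_level_def)
  ultimately show ?thesis by (simp add: local_level_def)
qed

lemma local_level_inverse:
  assumes "g \<in> local_level x r z"
  shows "matrix_inv g \<in> local_level x r z"
proof -
  have g: "g \<in> GL2 (local_int z)" using assms by (simp add: local_level_def)
  let ?h = "matrix_inv g"
  have "?h $ i $ j - mat 1 $ i $ j \<in> local_ideal x (int r)" if z: "z = x" for i j
  proof -
    have "(g ** ?h) $ i $ j = (mat 1 :: _^2^2) $ i $ j" by (simp only: GL2_inverse(2)[OF g])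
    then have "?h $ i $ j - mat 1 $ i $ j = - (\<Sum>k\<in>UNIV. (g $ i $ k - mat 1 $ i $ k) * ?h $ k $ j)"
      using exhaust_2[of i] by (auto simp: matrix_matrix_mult_def sum_2 mat_def algebra_simps)
    moreover have "(g $ i $ k - mat 1 $ i $ k) * ?h $ k $ j \<in> local_ideal x (int r)" for k
      using assms GL2_inverse(1)[OF g] z by (intro local_ideal_mult_int) (auto simp: local_level_def GL2_entry)
    ultimately show ?thesis by (simp add: sum_2 local_ideal_add local_ideal_uminus local_ideal_diff)
  qed
  then show ?thesis using GL2_inverse(1)[OF g] by (simp add: local_level_def)
qed

lemma local_level_one [simp]: "mat 1 \<in> local_level x r z"
  by (simp add: local_level_def GL2_one)

locale level_structure =
  fixes \<pi> :: "'k::finite_field place \<Rightarrow> 'k poly fract" and x :: "'k place" and r :: nat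
  assumes unif: "\<And>z. uniformizer z (\<pi> z)"
begin

abbreviation K where "K \<equiv> level_group \<pi> x r"

lemma level_group_iff: "k \<in> K \<longleftrightarrow> (\<forall>z. component z k \<in> local_level x r z)"
proof
  assume k: "k \<in> K"
  show "\<forall>z. component z k \<in> local_level x r z"
  proof
    fix z
    show "component z k \<in> local_level x r z"
      using k local_ideal_eq_uniformizer_mult[OF unif[of x], of _ r]
      unfolding level_group_def local_level_def by (cases "z = x") (auto simp del: component_nth)
  qed
next
  assume "\<forall>z. component z k \<in> local_level x r z"
  then show "k \<in> K"
    using local_ideal_eq_uniformizer_mult[OF unif[of x], of _ r]
    unfolding level_group_def local_level_def by (auto simp del: component_nth)
qed

lemma glue_level_group:
  assumes h: "\<And>z. h z \<in> local_level x r z"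
  shows "glue h \<in> K" "component z (glue h) = h z"
proof -
  have "h z $ i $ j \<in> local_int z" for z i j using h[of z] by (auto simp: local_level_def GL2_entry)
  then have *: "component z (glue h) = h z" for z
    by (intro component_glue[of _ "{}"]) (auto simp: local_int_iff)
  then show "component z (glue h) = h z" .
  show "glue h \<in> K" using * h by (simp add: level_group_iff del: component_nth)
qed

text \<open>
  The inverses of the components have integral entries everywhere, so they are the components of an
  adelic matrix.
\<close>

lemma level_group_inverse:
  assumes k: "k \<in> K"
  shows "matrix_inv k \<in> K" "k ** matrix_inv k = mat 1" "matrix_inv k ** k = mat 1"
proof -
  define h where "h = (\<lambda>z. matrix_inv (component z k))"
  have loc: "component z k \<in> local_level x r z" for z using k level_group_iff by blast
  then have h: "h z \<in> local_level x r z" for z by (simp add: h_def local_level_inverse)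
  have "component z k \<in> GL2 (local_int z)" for z using loc[of z] by (simp add: local_level_def)
  then have inv: "component z k ** h z = mat 1" "h z ** component z k = mat 1" for z
    unfolding h_def by (rule GL2_inverse)+
  note g = glue_level_group[OF h]
  have 1: "k ** glue h = mat 1" "glue h ** k = mat 1"
    by (rule component_eqI, simp only: component_mult g component_one inv)+
  then have "matrix_inv k = glue h" by (rule matrix_inv_eq)
  then show "matrix_inv k \<in> K" "k ** matrix_inv k = mat 1" "matrix_inv k ** k = mat 1"
    using g 1 by simp_all
qed

lemma level_group_mult: "k \<in> K \<Longrightarrow> k' \<in> K \<Longrightarrow> k ** k' \<in> K"
  by (simp add: level_group_iff component_mult local_level_mult del: component_nth)

lemma level_group_one: "mat 1 \<in> K"
  by (simp add: level_group_iff)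

lemma level_group_GL2:
  assumes "k \<in> K"
  shows "k \<in> GL2_adele" "k \<in> GL2 adele_int"
proof -
  have int: "k $ i $ j \<in> adele_int" if "k \<in> K" for k i j
  proof -
    have "component z k $ i $ j \<in> local_int z" for z
      using that level_group_iff by (auto simp: local_level_def GL2_entry simp del: component_nth)
    then show ?thesis by (simp add: adele_int_def)
  qed
  show "k \<in> GL2 adele_int"
    using level_group_inverse[OF assms] assms by (intro GL2_I[of _ _ "matrix_inv k"]) (auto intro: int)
  show "k \<in> GL2_adele"
    using level_group_inverse[OF assms] by (intro GL2_I[of _ _ "matrix_inv k"]) auto
qed

end

section \<open>Cosets of the level group are open\<close>

lemma fls_dist_vanish:
  fixes a b :: "'a::group_add fls"
  assumes "dist a b < inverse (2 ^ n)"
  shows "\<forall>i<int n. fls_nth (a - b) i = 0"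
proof (cases "a = b")
  case False
  let ?d = "fls_subdegree (a - b)"
  have "int n \<le> ?d"
  proof (rule ccontr)
    assume "\<not> int n \<le> ?d"
    then have "nat ?d \<le> n" by simp
    then have "inverse (2 ^ n) \<le> inverse (2 ^ nat ?d :: real)"
      by (simp add: power_increasing)
    moreover have "inverse (2 ^ n) \<le> (1::real)" "(1::real) \<le> 2 ^ nat (- ?d)"
      by (simp_all add: inverse_le_1_iff)
    ultimately show False using assms False unfolding dist_fls_def by (smt (verit))
  qed
  then show ?thesis by (meson fls_eq0_below_subdegree less_le_trans)
qed simp

lemma matrix_diff_ldistrib:
  fixes A B C :: "'a::comm_ring_1^2^2"
  shows "A ** (B - C) = A ** B - A ** C"
  by (rule mat2_eqI) (simp_all add: matrix_matrix_mult_def sum_2 algebra_simps)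

lemma matrix_diff_rdistrib:
  fixes A B C :: "'a::comm_ring_1^2^2"
  shows "(B - C) ** A = B ** A - C ** A"
  by (rule mat2_eqI) (simp_all add: matrix_matrix_mult_def sum_2 algebra_simps)

context level_structure
begin

text \<open>
  A matrix \<open>k\<close> lies in the level group if and only if it is invertible and the entries of \<open>k - 1\<close> and
  \<open>k\<^sup>-\<^sup>1 - 1\<close> lie in this ideal of the integral adeles.  In this form membership is an additive condition
  on the pair \<open>(k, k\<^sup>-\<^sup>1)\<close>, which is what the topology of the group refers to.
\<close>

definition level_ideal :: "'k adele set" where
  "level_ideal = {a. \<forall>z. adele_nth a z \<in> local_ideal z (if z = x then int r else 0)}"

lemma level_ideal_add: "a \<in> level_ideal \<Longrightarrow> b \<in> level_ideal \<Longrightarrow> a + b \<in> level_ideal"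
  by (simp add: level_ideal_def local_ideal_add)

text \<open>
  Changing \<open>b\<close> by an adele that is integral everywhere and sufficiently close to 0 at \<open>x\<close> and at the
  finitely many poles of \<open>c\<close> changes \<open>c (b - a)\<close> by an element of the ideal.
\<close>

lemma open_mult_level_ideal:
  fixes a c :: "'k adele"
  shows "open {b. c * (b - a) \<in> level_ideal}"
  unfolding open_adele_def
proof
  fix b0 assume b0: "b0 \<in> {b. c * (b - a) \<in> level_ideal}"
  define N where "N = (\<lambda>z. if z = x then int r else 0)"
  define S where "S = insert x {z. adele_nth c z \<notin> local_int z}"
  have S: "finite S" using adele_nth[of c] by (simp add: S_def)
  \<comment> \<open>A precision that is large enough at all places of \<open>S\<close> simultaneously.\<close>
  define M where "M = (\<Sum>z\<in>S. nat (N z - fls_subdegree (adele_nth c z)))"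
  have M: "N z - fls_subdegree (adele_nth c z) \<le> int M" if "z \<in> S" for z
    using member_le_sum[OF that, of "\<lambda>z. nat (N z - fls_subdegree (adele_nth c z))"] S
    unfolding M_def by linarith
  have "b \<in> {b. c * (b - a) \<in> level_ideal}" if b: "b \<in> adele_nbhd b0 S (inverse (2 ^ M))" for b
  proof -
    have "adele_nth c z * (adele_nth b z - adele_nth b0 z) \<in> local_ideal z (N z)" for z
    proof (cases "z \<in> S")
      case True
      then have "dist (adele_nth b z) (adele_nth b0 z) < inverse (2 ^ M)"
        using b by (simp add: adele_nbhd_def)
      from fls_dist_vanish[OF this] have "adele_nth b z - adele_nth b0 z \<in> local_ideal z (int M)"
        by (simp add: local_ideal_def local_field_diff)
      moreover have "adele_nth c z \<in> local_ideal z (fls_subdegree (adele_nth c z))"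
        by (simp add: local_ideal_def)
      ultimately have "adele_nth c z * (adele_nth b z - adele_nth b0 z) \<in>
          local_ideal z (fls_subdegree (adele_nth c z) + int M)"
        by (intro local_ideal_mult)
      then show ?thesis by (rule local_ideal_mono[rotated]) (use M[OF True] in simp)
    next
      case False
      then show ?thesis
        using b by (simp add: S_def N_def adele_nbhd_def local_ideal_0 local_int_mult)
    qed
    then have "c * (b - b0) \<in> level_ideal" by (simp add: level_ideal_def N_def)
    then have "c * (b - b0) + c * (b0 - a) \<in> level_ideal" using b0 by (intro level_ideal_add) auto
    then show ?thesis by (simp add: algebra_simps)
  qed
  then show "\<exists>S e. finite S \<and> 0 < e \<and> adele_nbhd b0 S e \<subseteq> {b. c * (b - a) \<in> level_ideal}"
    using S by (intro exI[of _ S] exI[of _ "inverse (2 ^ M)"]) auto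
qed

lemma open_matrix_level_ideal:
  fixes P Q D :: "'k adele^2^2"
  shows "open {A. \<forall>i j. (P ** (A - D) ** Q) $ i $ j \<in> level_ideal}" (is "open ?W")
  unfolding open_subopen[of ?W]
proof
  fix A0 assume A0: "A0 \<in> ?W"
  define V where "V k l = (\<Inter>i. \<Inter>j. {b. P $ i $ k * Q $ l $ j * (b - A0 $ k $ l) \<in> level_ideal})" for k l
  define T where "T = {A :: 'k adele^2^2. \<forall>k. A $ k \<in> {v. \<forall>l. v $ l \<in> V k l}}"
  have "open (V k l)" for k l unfolding V_def by (intro open_INT ballI finite open_mult_level_ideal)
  then have "open T" unfolding T_def by (intro open_vector_box allI)
  moreover have "0 \<in> level_ideal" by (simp add: level_ideal_def)
  then have "A0 \<in> T" by (simp add: T_def V_def)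
  moreover have "T \<subseteq> ?W"
  proof
    fix A assume A: "A \<in> T"
    have "(P ** (A - D) ** Q) $ i $ j \<in> level_ideal" for i j
    proof -
      have e: "P $ i $ k * Q $ l $ j * (A $ k $ l - A0 $ k $ l) \<in> level_ideal" for k l
        using A by (simp add: T_def V_def)
      have "(P ** (A - D) ** Q) $ i $ j = (P ** (A0 - D) ** Q) $ i $ j +
          (P $ i $ 1 * Q $ 1 $ j * (A $ 1 $ 1 - A0 $ 1 $ 1) + P $ i $ 1 * Q $ 2 $ j * (A $ 1 $ 2 - A0 $ 1 $ 2) +
          (P $ i $ 2 * Q $ 1 $ j * (A $ 2 $ 1 - A0 $ 2 $ 1) + P $ i $ 2 * Q $ 2 $ j * (A $ 2 $ 2 - A0 $ 2 $ 2)))"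
        by (simp add: matrix_matrix_mult_def sum_2 algebra_simps)
      moreover have "(P ** (A0 - D) ** Q) $ i $ j \<in> level_ideal" using A0 by simp
      ultimately show ?thesis using e by (simp only: level_ideal_add)
    qed
    then show "A \<in> ?W" by simp
  qed
  ultimately show "\<exists>T. open T \<and> A0 \<in> T \<and> T \<subseteq> ?W" by blast
qed

lemma level_groupI:
  assumes "\<forall>i j. (k - mat 1) $ i $ j \<in> level_ideal" "\<forall>i j. (k' - mat 1) $ i $ j \<in> level_ideal"
    and inv: "k ** k' = mat 1" "k' ** k = mat 1"
  shows "k \<in> K"
  unfolding level_group_iff
proof
  fix z
  have *: "component z a $ i $ j - mat 1 $ i $ j \<in> local_ideal z (if z = x then int r else 0)"
    if "\<forall>i j. (a - mat 1) $ i $ j \<in> level_ideal" for a i j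
  proof -
    have "adele_nth ((a - mat 1) $ i $ j) z = component z a $ i $ j - mat 1 $ i $ j"
      by (simp add: mat_def)
    moreover have "(a - mat 1) $ i $ j \<in> level_ideal" using that by simp
    then have "adele_nth ((a - mat 1) $ i $ j) z \<in> local_ideal z (if z = x then int r else 0)"
      unfolding level_ideal_def by simp
    ultimately show ?thesis by (simp only:)
  qed
  have int: "component z a $ i $ j \<in> local_int z" if "\<forall>i j. (a - mat 1) $ i $ j \<in> level_ideal" for a i j
  proof -
    have "component z a $ i $ j - mat 1 $ i $ j \<in> local_int z"
      by (rule local_ideal_int[OF _ *[OF that]]) simp
    moreover have "mat 1 $ i $ j \<in> local_int z" by (simp add: mat_def)
    ultimately have "component z a $ i $ j - mat 1 $ i $ j + mat 1 $ i $ j \<in> local_int z"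
      by (rule local_int_add)
    then show ?thesis by (simp only: diff_add_cancel)
  qed
  have "component z k \<in> GL2 (local_int z)"
  proof (rule GL2_I)
    show "component z k ** component z k' = mat 1" "component z k' ** component z k = mat 1"
      by (simp_all only: inv component_one flip: component_mult)
    show "\<forall>i j. component z k $ i $ j \<in> local_int z" "\<forall>i j. component z k' $ i $ j \<in> local_int z"
      by (intro allI int assms)+
  qed
  moreover have "\<forall>i j. component z k $ i $ j - mat 1 $ i $ j \<in> local_ideal x (int r)" if "z = x"
    using *[OF assms(1)] that by (simp del: component_nth)
  ultimately show "component z k \<in> local_level x r z"
    by (simp add: local_level_def del: component_nth)
qed

lemma level_group_ideal:
  assumes "k \<in> K"
  shows "(k - mat 1) $ i $ j \<in> level_ideal"
proof -
  have "adele_nth ((k - mat 1) $ i $ j) z = component z k $ i $ j - mat 1 $ i $ j" for z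
    by (simp add: mat_def)
  moreover have "component z k $ i $ j - mat 1 $ i $ j \<in> local_ideal z (if z = x then int r else 0)" for z
  proof -
    have k: "component z k \<in> local_level x r z" using assms level_group_iff by blast
    then have "component z k $ i $ j - mat 1 $ i $ j \<in> local_int z"
      by (intro local_int_diff) (auto simp: local_level_def GL2_entry mat_def simp del: component_nth)
    then show ?thesis using k by (auto simp: local_level_def local_ideal_0 simp del: component_nth)
  qed
  ultimately show ?thesis by (simp add: level_ideal_def del: component_nth)
qed

text \<open>
  An invertible matrix \<open>h\<close> lies in \<open>g K\<close> if and only if the entries of \<open>g\<^sup>-\<^sup>1 h - 1 = g\<^sup>-\<^sup>1 (h - g)\<close>
  and of \<open>h\<^sup>-\<^sup>1 g - 1 = (h\<^sup>-\<^sup>1 - g\<^sup>-\<^sup>1) g\<close> lie in the open ideal, and these are affine linear in the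
  two coordinates \<open>(h, h\<^sup>-\<^sup>1)\<close>.
\<close>

lemma openin_coset:
  assumes g: "g \<in> GL2_adele"
  shows "openin GL2_topology ((**) g ` K)"
proof -
  let ?H = "matrix_inv g"
  note gi = GL2_inverse[OF g]
  define W1 where "W1 = {A. \<forall>i j. (?H ** (A - g) ** mat 1) $ i $ j \<in> level_ideal}"
  define W2 where "W2 = {B. \<forall>i j. (mat 1 ** (B - ?H) ** g) $ i $ j \<in> level_ideal}"
  have 1: "?H ** (A - g) ** mat 1 = ?H ** A - mat 1" for A
    using gi by (simp add: matrix_diff_ldistrib)
  have 2: "mat 1 ** (B - ?H) ** g = B ** g - mat 1" for B
    using gi by (simp add: matrix_diff_rdistrib)
  have "(**) g ` K = (\<lambda>h. (h, matrix_inv h)) -` (W1 \<times> W2) \<inter> GL2_adele"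
  proof (intro equalityI subsetI)
    fix h assume "h \<in> (**) g ` K"
    then obtain k where k: "k \<in> K" "h = g ** k" by blast
    have h: "h \<in> GL2_adele" using GL2_UNIV_mult[OF g level_group_GL2(1)] k by simp
    note ki = level_group_inverse[OF k(1)]
    have "?H ** h = (?H ** g) ** k" unfolding k(2) by (rule matrix_mul_assoc)
    then have a: "?H ** h = k" by (simp only: gi matrix_mul_lid)
    have "matrix_inv h = matrix_inv k ** ?H"
    proof (rule matrix_inv_eq)
      have "h ** (matrix_inv k ** ?H) = g ** (k ** matrix_inv k) ** ?H"
        unfolding k(2) by (simp only: matrix_mul_assoc)
      then show "h ** (matrix_inv k ** ?H) = mat 1" by (simp only: ki gi matrix_mul_rid)
      have "(matrix_inv k ** ?H) ** h = matrix_inv k ** (?H ** g) ** k"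
        unfolding k(2) by (simp only: matrix_mul_assoc)
      then show "(matrix_inv k ** ?H) ** h = mat 1" by (simp only: ki gi matrix_mul_rid)
    qed
    then have "matrix_inv h ** g = matrix_inv k ** (?H ** g)" by (simp only: matrix_mul_assoc)
    then have b: "matrix_inv h ** g = matrix_inv k" by (simp only: gi matrix_mul_rid)
    show "h \<in> (\<lambda>h. (h, matrix_inv h)) -` (W1 \<times> W2) \<inter> GL2_adele"
      using h level_group_ideal[OF k(1)] level_group_ideal[OF ki(1)] unfolding W1_def W2_def 1 2
      by (simp only: a b mem_Collect_eq vimage_eq mem_Times_iff fst_conv snd_conv Int_iff) simp
  next
    fix h assume h: "h \<in> (\<lambda>h. (h, matrix_inv h)) -` (W1 \<times> W2) \<inter> GL2_adele"
    then have "h \<in> GL2_adele" by simp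
    note hi = GL2_inverse[OF this]
    have "?H ** h \<in> K"
    proof (rule level_groupI)
      show "\<forall>i j. (?H ** h - mat 1) $ i $ j \<in> level_ideal"
        "\<forall>i j. (matrix_inv h ** g - mat 1) $ i $ j \<in> level_ideal"
        using h unfolding W1_def W2_def 1 2 by simp_all
      have "?H ** h ** (matrix_inv h ** g) = ?H ** (h ** matrix_inv h) ** g" by (simp only: matrix_mul_assoc)
      then show "?H ** h ** (matrix_inv h ** g) = mat 1" by (simp only: hi gi matrix_mul_rid)
      have "matrix_inv h ** g ** (?H ** h) = matrix_inv h ** (g ** ?H) ** h" by (simp only: matrix_mul_assoc)
      then show "matrix_inv h ** g ** (?H ** h) = mat 1" by (simp only: hi gi matrix_mul_rid)
    qed
    moreover have "h = g ** (?H ** h)" by (simp only: matrix_mul_assoc gi matrix_mul_lid)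
    ultimately show "h \<in> (**) g ` K" by blast
  qed
  moreover have "open (W1 \<times> W2)"
    unfolding W1_def W2_def by (intro open_Times open_matrix_level_ideal)
  ultimately show ?thesis
    unfolding GL2_topology_def openin_pullback_topology
    by (intro exI[of _ "W1 \<times> W2"] conjI) (simp_all only: open_openin)
qed

end

section \<open>Volumes and the Hecke integral\<close>

locale level_haar = level_structure \<pi> x r
  for \<pi> :: "'k::finite_field place \<Rightarrow> 'k poly fract" and x r +
  fixes \<mu> :: "('k adele^2^2) measure"
  assumes haar: "haar_measure \<mu>" and vol: "emeasure \<mu> (GL2 adele_int) = 1"
begin

lemma topspace_GL2: "topspace GL2_topology = GL2_adele"
  by (simp add: GL2_topology_def topspace_pullback_topology)

lemma open_sets: "openin GL2_topology U \<Longrightarrow> U \<in> sets \<mu>"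
  using haar by (auto simp: haar_measure_def intro: sigma_sets.Basic)

lemma coset_sets: "g \<in> GL2_adele \<Longrightarrow> (**) g ` K \<in> sets \<mu>"
  by (intro open_sets openin_coset)

lemma level_group_sets: "K \<in> sets \<mu>"
  using coset_sets[of "mat 1"] by (simp add: GL2_one)

lemma emeasure_coset: "g \<in> GL2_adele \<Longrightarrow> emeasure \<mu> ((**) g ` K) = emeasure \<mu> K"
  using haar level_group_sets by (simp add: haar_measure_def)

text \<open>
  A compact set is covered by finitely many translates of the level group, so if the level group
  were a null set, then all compact sets and, by inner regularity, the whole group would be.
\<close>

lemma emeasure_level_group_pos: "emeasure \<mu> K \<noteq> 0"
proof
  assume 0: "emeasure \<mu> K = 0"
  have null_compact: "emeasure \<mu> C = 0" if C: "compactin GL2_topology C" for C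
  proof -
    have C_sub: "C \<subseteq> GL2_adele" using C compactin_subset_topspace topspace_GL2 by blast
    let ?U = "(\<lambda>g. (**) g ` K) ` C"
    have "C \<subseteq> \<Union>?U"
    proof
      fix g assume "g \<in> C"
      moreover have "g \<in> (**) g ` K" using level_group_one by (intro image_eqI[of _ _ "mat 1"]) simp_all
      ultimately show "g \<in> \<Union>?U" by blast
    qed
    moreover have "\<forall>U\<in>?U. openin GL2_topology U" using openin_coset C_sub by blast
    ultimately obtain F where F: "finite F" "F \<subseteq> ?U" "C \<subseteq> \<Union>F"
      using C unfolding compactin_def by metis
    have null: "U \<in> null_sets \<mu>" if "U \<in> F" for U
      using that F(2) C_sub coset_sets emeasure_coset 0 by (auto simp: null_sets_def)
    have "\<Union>F \<in> null_sets \<mu>"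
      using null_sets.finite_UN[OF F(1), of id \<mu>] null by simp
    then have "emeasure \<mu> (\<Union>F) = 0" "\<Union>F \<in> sets \<mu>" by auto
    then show ?thesis using emeasure_mono[OF F(3), of \<mu>] by simp
  qed
  have "openin GL2_topology GL2_adele" 
    using openin_topspace[of GL2_topology] by (simp only: topspace_GL2)
  moreover have "\<forall>U. openin GL2_topology U \<longrightarrow>
      emeasure \<mu> U = (SUP C\<in>{C. compactin GL2_topology C \<and> C \<subseteq> U}. emeasure \<mu> C)"
    using haar unfolding haar_measure_def by (elim conjE)
  ultimately have "emeasure \<mu> GL2_adele = (SUP C\<in>{C. compactin GL2_topology C \<and> C \<subseteq> GL2_adele}. emeasure \<mu> C)"
    by (elim allE impE)
  also have "\<dots> \<le> 0" using null_compact by (intro SUP_least) simp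
  finally have "emeasure \<mu> GL2_adele \<le> 0" .
  moreover have "space \<mu> = GL2_adele" "emeasure \<mu> (space \<mu>) \<noteq> 0"
    using haar unfolding haar_measure_def by blast+
  ultimately show False by simp
qed

lemma emeasure_level_group_finite: "emeasure \<mu> K < \<infinity>"
proof -
  have "GL2 adele_int \<in> sets \<mu>" using vol emeasure_notin_sets by fastforce
  moreover have "K \<subseteq> GL2 adele_int" using level_group_GL2 by blast
  ultimately have "emeasure \<mu> K \<le> 1" using emeasure_mono vol by metis
  then show ?thesis by (auto simp: less_top[symmetric] top_unique)
qed

lemma measure_level_group: "measure \<mu> K \<noteq> 0"
  using emeasure_level_group_pos emeasure_level_group_finite
  by (auto simp: measure_def enn2real_eq_0_iff)

text \<open>
  The function \<open>f (g h)\<close> of \<open>h\<close> is constant on every coset \<open>\<Xi> K\<close>, so the integrand is a step function,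
  and all its steps have the same volume as \<open>K\<close>, which is the normalization of the kernel.
\<close>

lemma hecke_action_coset_sum:
  fixes \<Xi> :: "'b \<Rightarrow> 'k adele^2^2"
  assumes P: "finite P" "\<And>w. w \<in> P \<Longrightarrow> \<Xi> w \<in> GL2_adele"
    and KdK: "{k ** at_place z (mat2 (place_embed z (\<pi> z)) 0 0 1) ** k' | k k'. k \<in> K \<and> k' \<in> K}
       = (\<Union>w\<in>P. (**) (\<Xi> w) ` K)"
    and disj: "\<And>w w' k k'. w \<in> P \<Longrightarrow> w' \<in> P \<Longrightarrow> k \<in> K \<Longrightarrow> k' \<in> K \<Longrightarrow> \<Xi> w ** k = \<Xi> w' ** k' \<Longrightarrow> w = w'"
    and f: "f \<in> automorphic K" and g: "g \<in> GL2_adele"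
  shows "hecke_action \<mu> (hecke_kernel \<mu> \<pi> x r z) f g = (\<Sum>w\<in>P. f (g ** \<Xi> w))"
proof -
  let ?v = "measure \<mu> K"
  let ?d = "at_place z (mat2 (place_embed z (\<pi> z)) 0 0 1)"
  let ?c = "\<lambda>w. f (g ** \<Xi> w) / complex_of_real ?v"
  have "has_bochner_integral \<mu> (\<lambda>h. \<Sum>w\<in>P. indicator ((**) (\<Xi> w) ` K) h *\<^sub>R ?c w)
      (\<Sum>w\<in>P. measure \<mu> ((**) (\<Xi> w) ` K) *\<^sub>R ?c w)"
    using P emeasure_coset emeasure_level_group_finite coset_sets
    by (intro has_bochner_integral_sum has_bochner_integral_indicator) auto
  moreover have "(\<Sum>w\<in>P. measure \<mu> ((**) (\<Xi> w) ` K) *\<^sub>R ?c w) = (\<Sum>w\<in>P. f (g ** \<Xi> w))"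
    using P(2) emeasure_coset measure_level_group
    by (intro sum.cong refl) (simp add: measure_def scaleR_conv_of_real)
  moreover have "(\<Sum>w\<in>P. indicator ((**) (\<Xi> w) ` K) h *\<^sub>R ?c w) = hecke_kernel \<mu> \<pi> x r z h * f (g ** h)" for h
  proof (cases "h \<in> (\<Union>w\<in>P. (**) (\<Xi> w) ` K)")
    case True
    then obtain w k where w: "w \<in> P" "k \<in> K" "h = \<Xi> w ** k" by (elim UN_E imageE) (rule that)
    have other: "h \<notin> (**) (\<Xi> w') ` K" if "w' \<in> P" "w' \<noteq> w" for w'
    proof
      assume "h \<in> (**) (\<Xi> w') ` K"
      then obtain k' where k': "h = \<Xi> w' ** k'" "k' \<in> K" by (rule imageE)
      have "\<Xi> w' ** k' = \<Xi> w ** k" by (simp only: w(3) k'(1)[symmetric])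
      then have "w' = w" by (rule disj[OF that(1) w(1) k'(2) w(2)])
      then show False using that(2) by contradiction
    qed
    have "h \<in> (**) (\<Xi> w) ` K" unfolding w(3) using w(2) by (rule imageI)
    then have "(\<Sum>w'\<in>P. indicator ((**) (\<Xi> w') ` K) h *\<^sub>R ?c w') = (\<Sum>w'\<in>P. if w' = w then ?c w' else 0)"
      using other by (intro sum.cong refl) (simp add: indicator_def)
    also have "\<dots> = ?c w" using P(1) w(1) by simp
    also have "f (g ** \<Xi> w) = f (g ** h)"
    proof -
      have "g ** \<Xi> w \<in> GL2_adele" using GL2_UNIV_mult g P(2) w(1) by blast
      then have "f (g ** \<Xi> w ** k) = f (g ** \<Xi> w)" using f w(2) unfolding automorphic_def by blast
      then show ?thesis by (simp add: w(3) matrix_mul_assoc)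
    qed
    finally show ?thesis
      using True unfolding hecke_kernel_def KdK by (simp only: indicator_simps) simp
  next
    case False
    then have "(\<Sum>w\<in>P. indicator ((**) (\<Xi> w) ` K) h *\<^sub>R ?c w) = 0"
      by (intro sum.neutral ballI) (auto simp: indicator_def)
    then show ?thesis
      using False unfolding hecke_kernel_def KdK by (simp only: indicator_simps) simp
  qed
  ultimately show ?thesis
    unfolding hecke_action_def by (metis (no_types, lifting) ext has_bochner_integral_integral_eq)
qed

end

section \<open>Vertices and multiplicities\<close>

lemma principal_adele_hom:
  fixes f g :: "'k::finite_field poly fract"
  shows "principal_adele (f + g) = principal_adele f + principal_adele g"
    "principal_adele (f * g) = principal_adele f * principal_adele g"
    "principal_adele (0 :: 'k poly fract) = 0" "principal_adele (1 :: 'k poly fract) = 1"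
  by (rule adele_eqI, simp add: adele_nth_principal_adele place_embed_add place_embed_mult)+

lemma map_matrix_principal_mult:
  fixes A B :: "'k::finite_field poly fract^2^2"
  shows "map_matrix principal_adele (A ** B) = map_matrix principal_adele A ** map_matrix principal_adele B"
  by (rule mat2_eqI) (simp_all add: map_matrix_def matrix_matrix_mult_def sum_2 principal_adele_hom)

lemma map_matrix_principal_one: "map_matrix principal_adele (mat 1 :: 'k::finite_field poly fract^2^2) = mat 1"
  by (rule mat2_eqI) (simp_all add: map_matrix_def mat_def principal_adele_hom)

lemma GL2_global_GL2: "\<gamma> \<in> GL2_global \<Longrightarrow> \<gamma> \<in> (GL2_adele :: ('k::finite_field adele^2^2) set)"
  and GL2_global_mult: "\<gamma> \<in> GL2_global \<Longrightarrow> \<gamma>' \<in> GL2_global \<Longrightarrow> \<gamma> ** \<gamma>' \<in> (GL2_global :: ('k adele^2^2) set)"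
  and GL2_global_inverse: "\<gamma> \<in> GL2_global \<Longrightarrow> matrix_inv \<gamma> \<in> (GL2_global :: ('k adele^2^2) set)"
  and GL2_global_one: "mat 1 \<in> (GL2_global :: ('k adele^2^2) set)"
proof -
  let ?m = "map_matrix principal_adele :: 'k poly fract^2^2 \<Rightarrow> 'k adele^2^2"
  show "mat 1 \<in> (GL2_global :: ('k adele^2^2) set)"
    unfolding GL2_global_def using map_matrix_principal_one[symmetric]
    by (rule image_eqI) (simp add: GL2_one)
  assume "\<gamma> \<in> GL2_global"
  then obtain A where A: "A \<in> GL2 UNIV" "\<gamma> = ?m A" unfolding GL2_global_def by (elim imageE)
  note Ai = GL2_inverse[OF A(1)]
  have "?m A ** ?m (matrix_inv A) = mat 1" "?m (matrix_inv A) ** ?m A = mat 1"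
    by (simp_all only: Ai map_matrix_principal_one flip: map_matrix_principal_mult)
  note i = this[folded A(2)]
  show "\<gamma> \<in> GL2_adele" by (rule GL2_I[OF _ _ i]) simp_all
  have "matrix_inv \<gamma> = ?m (matrix_inv A)" using i by (rule matrix_inv_eq)
  then show "matrix_inv \<gamma> \<in> GL2_global"
    unfolding GL2_global_def using Ai(1) by (rule image_eqI)
  assume "\<gamma>' \<in> GL2_global"
  then obtain B where B: "B \<in> GL2 UNIV" "\<gamma>' = ?m B" unfolding GL2_global_def by (elim imageE)
  have "\<gamma> ** \<gamma>' = ?m (A ** B)" by (simp only: A(2) B(2) map_matrix_principal_mult)
  then show "\<gamma> ** \<gamma>' \<in> GL2_global"
    unfolding GL2_global_def using GL2_UNIV_mult[OF A(1) B(1)] by (rule image_eqI)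
qed

lemma GL2_center_commute: "\<zeta> \<in> GL2_center \<Longrightarrow> g \<in> GL2_adele \<Longrightarrow> \<zeta> ** g = g ** \<zeta>"
  by (simp add: GL2_center_def)

lemma GL2_center_GL2: "\<zeta> \<in> GL2_center \<Longrightarrow> \<zeta> \<in> GL2_adele"
  by (simp add: GL2_center_def)

lemma GL2_center_one: "mat 1 \<in> GL2_center"
  by (simp add: GL2_center_def GL2_one)

lemma GL2_center_mult:
  assumes "\<zeta> \<in> GL2_center" "\<zeta>' \<in> GL2_center"
  shows "\<zeta> ** \<zeta>' \<in> GL2_center"
proof -
  have "\<zeta> ** \<zeta>' ** g = g ** (\<zeta> ** \<zeta>')" if g: "g \<in> GL2_adele" for g
  proof -
    have "\<zeta> ** \<zeta>' ** g = \<zeta> ** (\<zeta>' ** g)" by (simp only: matrix_mul_assoc)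
    also have "\<dots> = (\<zeta> ** g) ** \<zeta>'" by (simp only: GL2_center_commute[OF assms(2) g] matrix_mul_assoc)
    also have "\<dots> = g ** (\<zeta> ** \<zeta>')" by (simp only: GL2_center_commute[OF assms(1) g] matrix_mul_assoc)
    finally show ?thesis .
  qed
  then show ?thesis
    using GL2_UNIV_mult[OF assms[THEN GL2_center_GL2]] by (simp add: GL2_center_def)
qed

lemma GL2_center_inverse:
  assumes "\<zeta> \<in> GL2_center"
  shows "matrix_inv \<zeta> \<in> GL2_center"
proof -
  note i = GL2_inverse[OF GL2_center_GL2[OF assms]]
  have "matrix_inv \<zeta> ** g = g ** matrix_inv \<zeta>" if g: "g \<in> GL2_adele" for g
  proof -
    have "matrix_inv \<zeta> ** g = matrix_inv \<zeta> ** (g ** \<zeta>) ** matrix_inv \<zeta>"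
      by (simp only: matrix_mul_assoc[symmetric] i matrix_mul_rid)
    also have "\<dots> = (matrix_inv \<zeta> ** \<zeta>) ** g ** matrix_inv \<zeta>"
      by (simp only: GL2_center_commute[OF assms g, symmetric] matrix_mul_assoc)
    also have "\<dots> = g ** matrix_inv \<zeta>" by (simp only: i matrix_mul_lid)
    finally show ?thesis .
  qed
  then show ?thesis using i(1) by (simp add: GL2_center_def)
qed

text \<open>
  This gives bounded functions moderate growth with exponent 0: \<open>h powr 0\<close> is 1 for \<open>h \<noteq> 0\<close>, but 0 for
  \<open>h = 0\<close>.  At every place the local height is bounded below by the positive absolute value of the
  inverse determinant.
\<close>

lemma height_nonzero:
  fixes g :: "'k::finite_field adele^2^2"
  assumes "g \<in> GL2_adele"
  shows "height g \<noteq> 0"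
proof -
  have "local_height z (component z g) \<noteq> 0" for z
  proof -
    let ?h = "component z g"
    have "?h ** component z (matrix_inv g) = mat 1"
      by (simp only: GL2_inverse[OF assms] component_one flip: component_mult)
    then have "det ?h * det (component z (matrix_inv g)) = 1" by (simp only: det_I flip: det_mul)
    then have "inverse (det ?h) \<noteq> 0" by auto
    then have "0 < local_abs z (inverse (det ?h))" by (simp add: local_abs_def)
    also have "\<dots> \<le> local_height z ?h"
    proof -
      have "{local_abs z (?h $ i $ j) | i j. True} = (\<lambda>(i, j). local_abs z (?h $ i $ j)) ` UNIV" by auto
      then show ?thesis unfolding local_height_def by (intro Max_ge) auto
    qed
    finally show ?thesis by simp
  qed
  then show ?thesis unfolding height_def by (cases "finite {z. local_height z (component z g) \<noteq> 1}") auto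
qed

context level_structure
begin

lemma vertexI: "\<gamma> \<in> GL2_global \<Longrightarrow> \<zeta> \<in> GL2_center \<Longrightarrow> k \<in> K \<Longrightarrow> \<gamma> ** g ** (\<zeta> ** k) \<in> vertex K g"
  unfolding vertex_def by (intro CollectI exI[of _ \<gamma>] exI[of _ \<zeta>] exI[of _ k]) simp

lemma vertexE:
  assumes "h \<in> vertex K g"
  obtains \<gamma> \<zeta> k where "\<gamma> \<in> GL2_global" "\<zeta> \<in> GL2_center" "k \<in> K" "h = \<gamma> ** g ** (\<zeta> ** k)"
proof -
  have "\<exists>\<gamma> \<zeta> k. h = \<gamma> ** g ** (\<zeta> ** k) \<and> \<gamma> \<in> GL2_global \<and> \<zeta> \<in> GL2_center \<and> k \<in> K"
    using assms unfolding vertex_def by (rule CollectD)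
  then show thesis by (elim exE conjE) (rule that)
qed

lemma vertex_self: "g \<in> vertex K g"
  using vertexI[OF GL2_global_one GL2_center_one level_group_one, of g] by simp

lemma vertex_GL2:
  assumes "g \<in> GL2_adele" "h \<in> vertex K g"
  shows "h \<in> GL2_adele"
  using assms(2)
proof (rule vertexE)
  fix \<gamma> \<zeta> k assume "\<gamma> \<in> GL2_global" "\<zeta> \<in> GL2_center" "k \<in> K" and h: "h = \<gamma> ** g ** (\<zeta> ** k)"
  then show ?thesis unfolding h
    by (intro GL2_UNIV_mult GL2_global_GL2 GL2_center_GL2 level_group_GL2 assms)
qed

text \<open>
  Vertices are orbits: the level group commutes with the center, so the right factors \<open>\<zeta> k\<close> form a group,
  and so do the global matrices on the left.
\<close>

lemma vertex_subset:
  assumes g: "g \<in> GL2_adele" and h: "h \<in> vertex K g"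
  shows "vertex K h \<subseteq> vertex K g"
proof
  fix u assume "u \<in> vertex K h"
  then obtain \<gamma>' \<zeta>' k' where 2: "\<gamma>' \<in> GL2_global" "\<zeta>' \<in> GL2_center" "k' \<in> K" "u = \<gamma>' ** h ** (\<zeta>' ** k')"
    by (rule vertexE)
  obtain \<gamma> \<zeta> k where 1: "\<gamma> \<in> GL2_global" "\<zeta> \<in> GL2_center" "k \<in> K" "h = \<gamma> ** g ** (\<zeta> ** k)"
    using h by (rule vertexE)
  have "u = \<gamma>' ** \<gamma> ** g ** (\<zeta> ** (k ** \<zeta>') ** k')"
    unfolding 1(4) 2(4) by (simp only: matrix_mul_assoc)
  also have "k ** \<zeta>' = \<zeta>' ** k" by (rule GL2_center_commute[OF 2(2) level_group_GL2(1)[OF 1(3)], symmetric])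
  also have "\<gamma>' ** \<gamma> ** g ** (\<zeta> ** (\<zeta>' ** k) ** k') = \<gamma>' ** \<gamma> ** g ** (\<zeta> ** \<zeta>' ** (k ** k'))"
    by (simp only: matrix_mul_assoc)
  also have "\<dots> \<in> vertex K g"
    by (intro vertexI GL2_global_mult GL2_center_mult level_group_mult 1 2)
  finally show "u \<in> vertex K g" .
qed

lemma vertex_sym:
  assumes g: "g \<in> GL2_adele" and h: "h \<in> vertex K g"
  shows "g \<in> vertex K h"
proof -
  obtain \<gamma> \<zeta> k where 1: "\<gamma> \<in> GL2_global" "\<zeta> \<in> GL2_center" "k \<in> K" "h = \<gamma> ** g ** (\<zeta> ** k)"
    using h by (rule vertexE)
  note \<gamma>i = GL2_inverse[OF GL2_global_GL2[OF 1(1)]]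
  note \<zeta>i = GL2_inverse[OF GL2_center_GL2[OF 1(2)]]
  note ki = level_group_inverse[OF 1(3)]
  have c: "matrix_inv \<zeta> ** matrix_inv k = matrix_inv k ** matrix_inv \<zeta>"
    by (intro GL2_center_commute GL2_center_inverse 1 level_group_GL2 ki)
  have "matrix_inv \<gamma> ** h ** (matrix_inv \<zeta> ** matrix_inv k) =
      (matrix_inv \<gamma> ** \<gamma>) ** g ** (\<zeta> ** (k ** matrix_inv k) ** matrix_inv \<zeta>)"
    unfolding 1(4) c by (simp only: matrix_mul_assoc)
  then have "g = matrix_inv \<gamma> ** h ** (matrix_inv \<zeta> ** matrix_inv k)"
    by (simp only: \<gamma>i \<zeta>i ki matrix_mul_rid matrix_mul_lid)
  also have "\<dots> \<in> vertex K h"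
    by (intro vertexI GL2_global_inverse GL2_center_inverse 1 ki)
  finally show ?thesis .
qed

lemma vertex_eq:
  assumes g: "g \<in> GL2_adele" and h: "h \<in> vertex K g"
  shows "vertex K h = vertex K g"
  using vertex_subset[OF g h] vertex_subset[OF vertex_GL2[OF g h] vertex_sym[OF g h]] by (rule equalityI)

lemma automorphic_vertex:
  assumes f: "f \<in> automorphic K" and g: "g \<in> GL2_adele" and h: "h \<in> vertex K g"
  shows "f h = f g"
proof -
  obtain \<gamma> \<zeta> k where 1: "\<gamma> \<in> GL2_global" "\<zeta> \<in> GL2_center" "k \<in> K" "h = \<gamma> ** g ** (\<zeta> ** k)"
    using h by (rule vertexE)
  have inv: "f (\<gamma> ** u) = f u" "f (\<zeta> ** u) = f u" "f (u ** k) = f u" if "u \<in> GL2_adele" for u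
    using f that 1(1-3) unfolding automorphic_def by blast+
  have k: "k \<in> GL2_adele" using level_group_GL2 1 by blast
  have "h = \<gamma> ** ((g ** \<zeta>) ** k)" unfolding 1(4) by (simp only: matrix_mul_assoc)
  also have "g ** \<zeta> = \<zeta> ** g" by (rule GL2_center_commute[OF 1(2) g, symmetric])
  also have "f (\<gamma> ** (\<zeta> ** g ** k)) = f (\<zeta> ** g ** k)"
    by (intro inv GL2_UNIV_mult GL2_center_GL2 1 g k)
  also have "\<dots> = f (\<zeta> ** g)" by (intro inv GL2_UNIV_mult GL2_center_GL2 1 g)
  also have "\<dots> = f g" by (intro inv g)
  finally show ?thesis .
qed

lemma the_elem_vertex:
  assumes "f \<in> automorphic K" "g \<in> GL2_adele"
  shows "the_elem (f ` vertex K g) = f g"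
proof -
  have "f ` vertex K g = {f g}"
  proof (intro equalityI subsetI)
    fix c assume "c \<in> f ` vertex K g"
    then obtain h where "c = f h" "h \<in> vertex K g" by (rule imageE)
    then show "c \<in> {f g}" using automorphic_vertex[OF assms] by simp
  qed (simp add: vertex_self)
  then show ?thesis by simp
qed

lemma indicator_vertex_automorphic:
  assumes g: "g \<in> GL2_adele"
  shows "indicator (vertex K g) \<in> automorphic K"
proof -
  let ?f = "indicator (vertex K g) :: 'k adele^2^2 \<Rightarrow> complex"
  have eq: "?f u' = ?f u" if u: "u \<in> GL2_adele" "u' \<in> vertex K u" for u u'
  proof -
    have "u' \<in> vertex K g \<longleftrightarrow> u \<in> vertex K g"
      using vertex_subset[OF g, of u] vertex_subset[OF g, of u'] vertex_sym[OF u] u(2) by blast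
    then show ?thesis by (simp add: indicator_def)
  qed
  have "\<gamma> ** u \<in> vertex K u" if "\<gamma> \<in> GL2_global" for \<gamma> u
    using vertexI[OF that GL2_center_one level_group_one, of u] by simp
  moreover have "\<zeta> ** u \<in> vertex K u" if "\<zeta> \<in> GL2_center" "u \<in> GL2_adele" for \<zeta> u
    using vertexI[OF GL2_global_one that(1) level_group_one, of u] GL2_center_commute[OF that] by simp
  moreover have "u ** k \<in> vertex K u" if "k \<in> K" for k u
    using vertexI[OF GL2_global_one GL2_center_one that, of u] by simp
  moreover have "cmod (?f u) \<le> 1 * height u powr 0" if "u \<in> GL2_adele" for u
    using height_nonzero[OF that] by (simp add: indicator_def)
  ultimately show ?thesis
    unfolding automorphic_def by (intro CollectI conjI ballI eq exI[of _ 1] exI[of _ 0])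
qed

text \<open>
  The multiplicity of a vertex can be read off by applying the Hecke operator to the indicator function of
  that vertex, which is automorphic; so at most one function \<open>m\<close> has the defining property.
\<close>

lemma multiplicities_eq:
  assumes m: "finite {v. m v \<noteq> 0}" "{v. m v \<noteq> 0} \<subseteq> vertex K ` GL2_adele"
    and eq: "\<And>f. f \<in> automorphic K \<Longrightarrow>
      hecke_action \<mu> \<Phi> f g = (\<Sum>v | m v \<noteq> 0. m v * the_elem (f ` v))"
  shows "multiplicities \<mu> K \<Phi> g = m"
  unfolding multiplicities_def
proof (rule the_equality)
  show "finite {v. m v \<noteq> 0} \<and> {v. m v \<noteq> 0} \<subseteq> vertex K ` GL2_adele \<and>
     (\<forall>f\<in>automorphic K. hecke_action \<mu> \<Phi> f g = (\<Sum>v | m v \<noteq> 0. m v * the_elem (f ` v)))"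
    using m eq by blast
next
  have coeff: "hecke_action \<mu> \<Phi> (indicator (vertex K u)) g = n (vertex K u)"
    if n: "finite {v. n v \<noteq> 0}" "{v. n v \<noteq> 0} \<subseteq> vertex K ` GL2_adele"
      "\<forall>f\<in>automorphic K. hecke_action \<mu> \<Phi> f g = (\<Sum>v | n v \<noteq> 0. n v * the_elem (f ` v))"
      and u: "u \<in> GL2_adele" for n :: "('k adele^2^2) set \<Rightarrow> complex" and u
  proof -
    let ?f = "indicator (vertex K u) :: 'k adele^2^2 \<Rightarrow> complex"
    have f: "?f \<in> automorphic K" using u by (rule indicator_vertex_automorphic)
    have "n v * the_elem (?f ` v) = (if v = vertex K u then n v else 0)" if "v \<in> {v. n v \<noteq> 0}" for v
    proof -
      obtain h where h: "h \<in> GL2_adele" "v = vertex K h" using \<open>v \<in> _\<close> n(2) by blast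
      have "h \<in> vertex K u \<longleftrightarrow> v = vertex K u"
        using vertex_eq[OF u, of h] vertex_self[of h] h(2) by blast
      then show ?thesis using the_elem_vertex[OF f h(1)] h(2) by (simp add: indicator_def)
    qed
    then have "(\<Sum>v | n v \<noteq> 0. n v * the_elem (?f ` v)) = (\<Sum>v | n v \<noteq> 0. if v = vertex K u then n v else 0)"
      by (rule sum.cong[OF refl])
    also have "\<dots> = n (vertex K u)" using n(1) by (simp add: sum.delta)
    finally show ?thesis using n(3) f by simp
  qed
  fix n :: "('k adele^2^2) set \<Rightarrow> complex"
  assume n: "finite {v. n v \<noteq> 0} \<and> {v. n v \<noteq> 0} \<subseteq> vertex K ` GL2_adele \<and>
     (\<forall>f\<in>automorphic K. hecke_action \<mu> \<Phi> f g = (\<Sum>v | n v \<noteq> 0. n v * the_elem (f ` v)))"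
  show "n = m"
  proof
    fix v
    show "n v = m v"
    proof (cases "v \<in> vertex K ` GL2_adele")
      case True
      then obtain u where u: "v = vertex K u" "u \<in> GL2_adele" by (rule imageE)
      have "hecke_action \<mu> \<Phi> (indicator (vertex K u)) g = n (vertex K u)"
        using n u(2) by (intro coeff) blast+
      moreover have "hecke_action \<mu> \<Phi> (indicator (vertex K u)) g = m (vertex K u)"
        using m eq u(2) by (intro coeff) blast+
      ultimately show ?thesis unfolding u(1) by simp
    next
      case False
      then have "n v = 0" "m v = 0" using n m(2) by blast+
      then show ?thesis by simp
    qed
  qed
qed

text \<open>
  Terms that belong to the same vertex contribute the same value of \<open>f\<close> and are collected.
\<close>

lemma multiplicities_of_sum:
  fixes h :: "'b \<Rightarrow> 'k adele^2^2"
  assumes P: "finite P" "\<And>w. w \<in> P \<Longrightarrow> h w \<in> GL2_adele"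
    and eq: "\<And>f. f \<in> automorphic K \<Longrightarrow> hecke_action \<mu> \<Phi> f g = (\<Sum>w\<in>P. f (h w))"
  shows "multiplicities \<mu> K \<Phi> g = (\<lambda>v. of_nat (card {w \<in> P. vertex K (h w) = v}))"
proof -
  let ?v = "\<lambda>w. vertex K (h w)"
  let ?m = "\<lambda>v. of_nat (card {w \<in> P. ?v w = v}) :: complex"
  have supp: "{v. ?m v \<noteq> 0} = ?v ` P" using P(1) by auto
  show ?thesis
  proof (rule multiplicities_eq)
    show "finite {v. ?m v \<noteq> 0}" unfolding supp using P(1) by simp
    show "{v. ?m v \<noteq> 0} \<subseteq> vertex K ` GL2_adele" unfolding supp using P(2) by blast
    fix f assume f: "f \<in> automorphic K"
    have "(\<Sum>v | ?m v \<noteq> 0. ?m v * the_elem (f ` v)) = (\<Sum>v\<in>?v ` P. \<Sum>w | w \<in> P \<and> ?v w = v. f (h w))"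
      unfolding supp
    proof (rule sum.cong[OF refl])
      fix v
      have "(\<Sum>w | w \<in> P \<and> ?v w = v. f (h w)) = (\<Sum>w | w \<in> P \<and> ?v w = v. the_elem (f ` v))"
        using the_elem_vertex[OF f] P(2) by (intro sum.cong[OF refl]) auto
      then show "?m v * the_elem (f ` v) = (\<Sum>w | w \<in> P \<and> ?v w = v. f (h w))" by simp
    qed
    also have "\<dots> = (\<Sum>w\<in>P. f (h w))"
      using P(1) by (intro sum.group) auto
    finally show "hecke_action \<mu> \<Phi> f g = (\<Sum>v | ?m v \<noteq> 0. ?m v * the_elem (f ` v))"
      using eq[OF f] by simp
  qed
qed

end

context level_haar
begin

text \<open>
  This reduces both parts of the theorem to finding representatives of the left cosets of the level
  group in the double coset of the Hecke operator: each of them contributes 1 to the multiplicity of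
  its vertex, and multiplicities cannot cancel.
\<close>

lemma neighbors_of_coset_representatives:
  fixes \<Xi> :: "'b \<Rightarrow> 'k adele^2^2"
  defines "d z \<equiv> at_place z (mat2 (place_embed z (\<pi> z)) 0 0 1)"
  assumes P: "finite P" "\<And>w. w \<in> P \<Longrightarrow> \<Xi> w \<in> GL2_adele"
    and KdK: "{k ** d z ** k' | k k'. k \<in> K \<and> k' \<in> K} = (\<Union>w\<in>P. (**) (\<Xi> w) ` K)"
    and disj: "\<And>w w' k k'. w \<in> P \<Longrightarrow> w' \<in> P \<Longrightarrow> k \<in> K \<Longrightarrow> k' \<in> K \<Longrightarrow> \<Xi> w ** k = \<Xi> w' ** k' \<Longrightarrow> w = w'"
    and g: "g \<in> GL2_adele"
  defines "m \<equiv> multiplicities \<mu> K (hecke_kernel \<mu> \<pi> x r z) g"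
    and "N \<equiv> neighbors \<mu> K (hecke_kernel \<mu> \<pi> x r z) g"
    and "v w \<equiv> vertex K (g ** \<Xi> w)"
  shows "N = v ` P" "\<And>w. m (v w) = of_nat (card {w' \<in> P. v w' = v w})" "finite N"
    "(\<Sum>u\<in>N. m u) = of_nat (card P)"
proof -
  have m: "m = (\<lambda>u. of_nat (card {w \<in> P. v w = u}))"
    unfolding m_def v_def
  proof (rule multiplicities_of_sum[OF P(1)])
    show "g ** \<Xi> w \<in> GL2_adele" if "w \<in> P" for w using GL2_UNIV_mult[OF g P(2)[OF that]] .
    show "hecke_action \<mu> (hecke_kernel \<mu> \<pi> x r z) f g = (\<Sum>w\<in>P. f (g ** \<Xi> w))" if "f \<in> automorphic K" for f
      using hecke_action_coset_sum[OF P KdK[unfolded d_def] disj that g] .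
  qed
  show N: "N = v ` P" unfolding N_def neighbors_def m_def[symmetric] unfolding m using P(1) by auto
  show "finite N" unfolding N using P(1) by simp
  show "m (v w) = of_nat (card {w' \<in> P. v w' = v w})" for w by (simp add: m)
  have "(\<Sum>u\<in>v ` P. \<Sum>w | w \<in> P \<and> v w = u. 1 :: complex) = (\<Sum>w\<in>P. 1)"
    using P(1) by (intro sum.group) auto
  then show "(\<Sum>u\<in>N. m u) = of_nat (card P)" unfolding N m by simp
qed

end

section \<open>Local coset representatives\<close>

lemma local_int_nth_mult:
  "a \<in> local_int z \<Longrightarrow> b \<in> local_int z \<Longrightarrow> fls_nth (a * b) 0 = fls_nth a 0 * fls_nth b 0"
  by (intro fls_nth_0_mult_integral) (simp_all add: local_int_iff)

lemma finite_proj_line: "finite R \<Longrightarrow> finite (proj_line R)"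
  by (simp add: proj_line_def)

lemma card_proj_line: "finite R \<Longrightarrow> card (proj_line R) = card R + 1"
  by (subst proj_line_def, subst card_insert_disjoint) (auto simp: card_image inj_on_def)

context level_structure
begin

text \<open>
  Left cosets of the level group in a double coset of a matrix supported at one place are
  governed by the group at this place alone, because the other components can be moved freely
  into the level group.
\<close>

lemma cosets_at_place:
  fixes \<xi> :: "'b \<Rightarrow> 'k alg_closure fls^2^2" and d :: "'k alg_closure fls^2^2"
  assumes d: "d \<in> GL2 (local_field z)" and \<xi>: "\<And>w. w \<in> P \<Longrightarrow> \<xi> w \<in> GL2 (local_field z)"
    and a: "\<And>l. l \<in> local_level x r z \<Longrightarrow> \<exists>w\<in>P. \<exists>l'\<in>local_level x r z. l ** d = \<xi> w ** l'"
    and b: "\<And>w. w \<in> P \<Longrightarrow> \<exists>l\<in>local_level x r z. \<exists>l'\<in>local_level x r z. \<xi> w = l ** d ** l'"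
    and c: "\<And>w w' l l'. w \<in> P \<Longrightarrow> w' \<in> P \<Longrightarrow> l \<in> local_level x r z \<Longrightarrow> l' \<in> local_level x r z \<Longrightarrow>
      \<xi> w ** l = \<xi> w' ** l' \<Longrightarrow> w = w'"
  shows "{k ** at_place z d ** k' | k k'. k \<in> K \<and> k' \<in> K} = (\<Union>w\<in>P. (**) (at_place z (\<xi> w)) ` K)"
    and "\<And>w w' k k'. w \<in> P \<Longrightarrow> w' \<in> P \<Longrightarrow> k \<in> K \<Longrightarrow> k' \<in> K \<Longrightarrow>
      at_place z (\<xi> w) ** k = at_place z (\<xi> w') ** k' \<Longrightarrow> w = w'"
proof -
  have cd: "component y (at_place z d) = (if y = z then d else mat 1)" for y
    by (intro component_at_place GL2_entry d)
  have c\<xi>: "component y (at_place z (\<xi> w)) = (if y = z then \<xi> w else mat 1)" if "w \<in> P" for y w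
    by (intro component_at_place GL2_entry \<xi> that)
  have level_field: "l $ i $ j \<in> local_field z" if "l \<in> local_level x r z" for l i j
    using that GL2_entry[of l "local_int z" i j] by (simp add: local_level_def local_int_iff)
  have cl: "component y (at_place z l) = (if y = z then l else mat 1)" if "l \<in> local_level x r z" for y l
    by (intro component_at_place level_field that)
  have al: "at_place z l \<in> K" if "l \<in> local_level x r z" for l
    unfolding level_group_iff using that by (simp add: cl del: component_nth)
  show "{k ** at_place z d ** k' | k k'. k \<in> K \<and> k' \<in> K} = (\<Union>w\<in>P. (**) (at_place z (\<xi> w)) ` K)"
  proof (intro equalityI subsetI)
    fix h assume "h \<in> {k ** at_place z d ** k' | k k'. k \<in> K \<and> k' \<in> K}"
    then have "\<exists>k k'. h = k ** at_place z d ** k' \<and> k \<in> K \<and> k' \<in> K" by (rule CollectD)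
    then obtain k k' where k: "k \<in> K" "k' \<in> K" "h = k ** at_place z d ** k'" by (elim exE conjE)
    have loc: "component y k \<in> local_level x r y" for y using k(1) level_group_iff by blast
    obtain w l where w: "w \<in> P" "l \<in> local_level x r z" "component z k ** d = \<xi> w ** l"
      using a[OF loc] by blast
    let ?h = "\<lambda>y. if y = z then l else component y k"
    have hl: "?h y \<in> local_level x r y" for y using w(2) loc[of y] by simp
    note glue = glue_level_group[OF hl]
    have "k ** at_place z d = at_place z (\<xi> w) ** glue ?h"
      by (rule component_eqI) (simp add: component_mult cd c\<xi>[OF w(1)] glue(2) w(3) del: component_nth)
    then have "h = at_place z (\<xi> w) ** (glue ?h ** k')" unfolding k(3) by (simp only: matrix_mul_assoc)
    moreover have "glue ?h ** k' \<in> K" by (rule level_group_mult[OF glue(1) k(2)])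
    ultimately show "h \<in> (\<Union>w\<in>P. (**) (at_place z (\<xi> w)) ` K)"
      using w(1) by (intro UN_I image_eqI)
  next
    fix h assume "h \<in> (\<Union>w\<in>P. (**) (at_place z (\<xi> w)) ` K)"
    then obtain w k where w: "w \<in> P" "k \<in> K" "h = at_place z (\<xi> w) ** k"
      by (elim UN_E imageE) (rule that)
    obtain l l' where l: "l \<in> local_level x r z" "l' \<in> local_level x r z" "\<xi> w = l ** d ** l'"
      using b[OF w(1)] by blast
    have "at_place z (\<xi> w) = at_place z l ** at_place z d ** at_place z l'"
      by (rule component_eqI)
         (simp add: component_mult cd c\<xi>[OF w(1)] cl[OF l(1)] cl[OF l(2)] del: component_nth flip: l(3))
    then have "h = at_place z l ** at_place z d ** (at_place z l' ** k)"
      unfolding w(3) by (simp only: matrix_mul_assoc)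
    moreover have "at_place z l' ** k \<in> K" by (rule level_group_mult[OF al[OF l(2)] w(2)])
    ultimately show "h \<in> {k ** at_place z d ** k' | k k'. k \<in> K \<and> k' \<in> K}"
      using al[OF l(1)] by (intro CollectI exI conjI)
  qed
  fix w w' k k' assume w: "w \<in> P" "w' \<in> P" and k: "k \<in> K" "k' \<in> K"
    and e: "at_place z (\<xi> w) ** k = at_place z (\<xi> w') ** k'"
  have "component z (at_place z (\<xi> w) ** k) = component z (at_place z (\<xi> w') ** k')" by (simp only: e)
  then have "\<xi> w ** component z k = \<xi> w' ** component z k'"
    by (simp add: component_mult c\<xi>[OF w(1)] c\<xi>[OF w(2)] del: component_nth)
  moreover have "component z k \<in> local_level x r z" "component z k' \<in> local_level x r z"
    using k level_group_iff by blast+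
  ultimately show "w = w'" using c[OF w] by blast
qed

abbreviation unif_at where "unif_at z \<equiv> place_embed z (\<pi> z)"

lemma unif_at: "unif_at z \<noteq> 0" "unif_at z \<in> local_int z" "fls_nth (unif_at z) 0 = 0"
  using unif[of z] by (auto simp: uniformizer_def local_int_def)

lemma unif_nonzero [simp]: "\<pi> z \<noteq> 0"
  using unif_at(1)[of z] by simp

lemma local_ideal_div_unif:
  assumes "a \<in> local_ideal z (n + 1)"
  shows "a / unif_at z \<in> local_ideal z n"
  using local_ideal_uniformizer[OF unif, of z 1 "a / unif_at z" n] assms unif_at(1)[of z]
  by (simp add: add.commute)

lemma hecke_matrix_GL2: "mat2 (unif_at z) 0 0 1 \<in> GL2 (local_field z)"
  by (rule GL2_local_field_I) (simp_all add: unif_at)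

lemma xi_GL2:
  assumes "w \<in> proj_line (residue_field z)"
  shows "xi \<pi> z w \<in> GL2 (local_field z)"
proof (cases w)
  case Pt01
  then show ?thesis by (auto intro!: GL2_local_field_I simp: unif_at)
next
  case (Pt1 s)
  then have "fls_const s \<in> local_int z"
    using assms residue_field_const_local_int[of s z] by (auto simp: proj_line_def)
  then show ?thesis using Pt1 by (auto intro!: GL2_local_field_I simp: unif_at local_int_iff)
qed

lemma xi_ram_GL2: "xi_ram \<pi> x r a \<in> GL2 (local_field x)"
proof -
  have "fls_const (to_ac a) \<in> local_field x" using local_int_const[of a x] by (simp add: local_int_iff)
  moreover have "unif_at x ^ n \<in> local_field x" for n
    by (induction n) (auto intro: local_field_mult)
  ultimately show ?thesis unfolding xi_ram_def
    by (intro GL2_local_field_I local_field_mult) (simp_all add: unif_at)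
qed

text \<open>
  Away from the level, the coset of \<open>l d\<close> only depends on the second column \<open>(b, e)\<close> of \<open>l\<close>
  modulo the maximal ideal, viewed as a point of the projective line over the residue field.
\<close>

lemma unramified_coset:
  assumes l: "l \<in> GL2 (local_int z)"
  shows "\<exists>w\<in>proj_line (residue_field z). \<exists>l'\<in>GL2 (local_int z).
    l ** mat2 (unif_at z) 0 0 1 = xi \<pi> z w ** l'"
proof -
  let ?t = "unif_at z"
  obtain a b c e where l_eq: "l = mat2 a b c e" by (rule mat2_exhaust)
  have abce: "a \<in> local_int z" "b \<in> local_int z" "c \<in> local_int z" "e \<in> local_int z"
    and det: "fls_nth (a * e - b * c) 0 \<noteq> 0"
    using l unfolding l_eq GL2_local_int_iff by blast+
  have t: "?t \<noteq> 0" "?t \<in> local_int z" by (fact unif_at)+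
  show ?thesis
  proof (cases "fls_nth e 0 = 0")
    case True
    then have "e \<in> local_ideal z 1" using abce local_ideal_1_iff by blast
    then have "e / ?t \<in> local_int z" using local_ideal_div_unif[of e z 0] by (simp add: local_ideal_0)
    then have "mat2 (a * ?t) b c (e / ?t) \<in> GL2 (local_int z)"
      unfolding GL2_local_int_iff using abce t det by (simp add: local_int_mult)
    moreover have "l ** mat2 ?t 0 0 1 = xi \<pi> z Pt01 ** mat2 (a * ?t) b c (e / ?t)"
      using t(1) by (simp add: l_eq mat2_mult mult.commute)
    moreover have "Pt01 \<in> proj_line (residue_field z)" by (simp add: proj_line_def)
    ultimately show ?thesis by blast
  next
    case False
    then have ie: "inverse e \<in> local_int z" "e \<noteq> 0" using abce local_int_inverse by auto
    define s where "s = fls_nth (b * inverse e) 0"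
    have s: "s \<in> residue_field z" unfolding s_def using abce ie by (intro residue_field_lift local_int_mult)
    let ?S = "fls_const s"
    have S: "?S \<in> local_int z" using s by (rule residue_field_const_local_int)
    have "b * inverse e - ?S \<in> local_ideal z 1"
      using local_ideal_1_iff[OF local_int_diff[OF local_int_mult[OF abce(2) ie(1)] S]] by (simp add: s_def)
    then have "(b * inverse e - ?S) * e \<in> local_ideal z 1" using abce by (intro local_ideal_mult_int)
    moreover have "(b * inverse e - ?S) * e = b - ?S * e" using ie by (simp add: algebra_simps)
    ultimately have "(b - ?S * e) / ?t \<in> local_int z"
      using local_ideal_div_unif[of "b - ?S * e" z 0] by (simp add: local_ideal_0)
    moreover have "(a - ?S * c) * e - (b - ?S * e) / ?t * (c * ?t) = a * e - b * c"
      using t(1) by (simp add: field_simps)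
    ultimately have "mat2 (a - ?S * c) ((b - ?S * e) / ?t) (c * ?t) e \<in> GL2 (local_int z)"
      unfolding GL2_local_int_iff using abce t(2) det S by (simp add: local_int_mult local_int_diff)
    moreover have "l ** mat2 ?t 0 0 1 = xi \<pi> z (Pt1 s) ** mat2 (a - ?S * c) ((b - ?S * e) / ?t) (c * ?t) e"
      using t(1) by (simp add: l_eq mat2_mult field_simps)
    moreover have "Pt1 s \<in> proj_line (residue_field z)" using s by (simp add: proj_line_def)
    ultimately show ?thesis by blast
  qed
qed

text \<open>
  The matrix at the point \<open>[0:1]\<close> is obtained from the Hecke matrix by conjugation with the swap of
  coordinates, which belongs to the full local group but not to a deeper level.
\<close>

lemma unramified_representative:
  assumes "w \<in> proj_line (residue_field z)"
  shows "\<exists>l\<in>GL2 (local_int z). \<exists>l'\<in>GL2 (local_int z). xi \<pi> z w = l ** mat2 (unif_at z) 0 0 1 ** l'"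
proof (cases w)
  case Pt01
  have "mat2 0 1 1 0 \<in> GL2 (local_int z)" by (simp add: GL2_local_int_iff)
  moreover have "xi \<pi> z w = mat2 0 1 1 0 ** mat2 (unif_at z) 0 0 1 ** mat2 0 1 1 0"
    by (simp add: Pt01 mat2_mult)
  ultimately show ?thesis by blast
next
  case (Pt1 s)
  then have "fls_const s \<in> local_int z"
    using assms residue_field_const_local_int[of s z] by (auto simp: proj_line_def)
  then have "mat2 1 (fls_const s) 0 1 \<in> GL2 (local_int z)" by (simp add: GL2_local_int_iff)
  moreover have "mat2 1 0 0 1 \<in> GL2 (local_int z)" by (simp add: GL2_local_int_iff)
  moreover have "xi \<pi> z w = mat2 1 (fls_const s) 0 1 ** mat2 (unif_at z) 0 0 1 ** mat2 1 0 0 1"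
    by (simp add: Pt1 mat2_mult)
  ultimately show ?thesis by blast
qed

text \<open>
  Modulo the maximal ideal, the first row of \<open>\<xi> l\<close> is \<open>s\<close> times its second row if \<open>\<xi>\<close> belongs to the point
  \<open>[1:s]\<close>, whereas its second row vanishes if \<open>\<xi>\<close> belongs to \<open>[0:1]\<close>.  So the point can be recovered from \<open>\<xi> l\<close>.
\<close>

lemma unramified_disjoint:
  assumes w: "w \<in> proj_line (residue_field z)" "w' \<in> proj_line (residue_field z)"
    and l: "l \<in> GL2 (local_int z)" "l' \<in> GL2 (local_int z)"
    and eq: "xi \<pi> z w ** l = xi \<pi> z w' ** l'"
  shows "w = w'"
proof -
  let ?t = "unif_at z"
  \<comment> \<open>The second row of an invertible integral matrix does not vanish modulo the maximal ideal.\<close>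
  have row: "fls_nth c 0 \<noteq> 0 \<or> fls_nth e 0 \<noteq> 0" if "mat2 a b c e \<in> GL2 (local_int z)" for a b c e
    using that unfolding GL2_local_int_iff by (auto simp: local_int_nth_mult)
  have t0: "fls_nth (?t * a) 0 = 0" if "a \<in> local_int z" for a
    using that unif_at[of z] by (simp add: local_int_nth_mult)
  have not_01: "False" if "mat2 1 0 0 ?t ** m = xi \<pi> z (Pt1 s) ** m'"
    "m \<in> GL2 (local_int z)" "m' \<in> GL2 (local_int z)" for m m' s
  proof -
    obtain a b c e where m: "m = mat2 a b c e" by (rule mat2_exhaust)
    obtain a' b' c' e' where m': "m' = mat2 a' b' c' e'" by (rule mat2_exhaust)
    have "c' = ?t * c" "e' = ?t * e" using that(1) by (simp_all add: m m' mat2_mult)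
    moreover have "c \<in> local_int z" "e \<in> local_int z" using that(2) unfolding m GL2_local_int_iff by blast+
    ultimately show False using row[of a' b' c' e'] that(3) t0 by (simp add: m')
  qed
  show ?thesis
  proof (cases w; cases w')
    fix s s' assume s: "w = Pt1 s" "w' = Pt1 s'"
    obtain a b c e where m: "l = mat2 a b c e" by (rule mat2_exhaust)
    obtain a' b' c' e' where m': "l' = mat2 a' b' c' e'" by (rule mat2_exhaust)
    have ints: "a \<in> local_int z" "b \<in> local_int z" "a' \<in> local_int z" "b' \<in> local_int z"
      using l unfolding m m' GL2_local_int_iff by blast+
    have "mat2 (?t * a + fls_const s * c) (?t * b + fls_const s * e) c e =
        mat2 (?t * a' + fls_const s' * c') (?t * b' + fls_const s' * e') c' e'"
      using eq by (simp only: s m m' xi.simps mat2_mult mult_zero_left mult_1_left add_0)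
    then have "c' = c" "e' = e" "?t * a + fls_const s * c = ?t * a' + fls_const s' * c'"
      "?t * b + fls_const s * e = ?t * b' + fls_const s' * e'" unfolding mat2_eq_iff by blast+
    then have e: "?t * a + fls_const s * c = ?t * a' + fls_const s' * c"
      "?t * b + fls_const s * e = ?t * b' + fls_const s' * e" by (simp_all only:)
    have "fls_nth (?t * a + fls_const s * c) 0 = fls_nth (?t * a' + fls_const s' * c) 0"
      "fls_nth (?t * b + fls_const s * e) 0 = fls_nth (?t * b' + fls_const s' * e) 0"
      by (simp_all only: e)
    then have "s * fls_nth c 0 = s' * fls_nth c 0" "s * fls_nth e 0 = s' * fls_nth e 0"
      using ints by (simp_all add: t0)
    then show "w = w'" using row[of a b c e] l(1) s by (auto simp: m)
  next
    fix s assume "w = Pt01" "w' = Pt1 s"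
    then show "w = w'" using not_01[of l s l'] eq l by simp
  next
    fix s assume "w = Pt1 s" "w' = Pt01"
    then show "w = w'" using not_01[of l' s l] eq l by simp
  qed simp
qed

lemma local_level_ramified_iff:
  assumes r: "r \<ge> 1"
  shows "mat2 a b c e \<in> local_level x r x \<longleftrightarrow> a - 1 \<in> local_ideal x (int r) \<and> b \<in> local_ideal x (int r) \<and>
     c \<in> local_ideal x (int r) \<and> e - 1 \<in> local_ideal x (int r)" (is "?l \<longleftrightarrow> ?r")
proof
  assume ?l
  then have "\<forall>i j. mat2 a b c e $ i $ j - mat 1 $ i $ j \<in> local_ideal x (int r)"
    by (simp add: local_level_def)
  then show ?r by (simp add: mat2_one forall_2)
next
  assume i: ?r
  have int1: "u \<in> local_ideal x (int r) \<Longrightarrow> u \<in> local_int x \<and> fls_nth u 0 = 0" for u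
    using r local_ideal_int[of "int r" u x] by (auto simp: local_ideal_def)
  have one: "u \<in> local_int x \<and> fls_nth u 0 = 1" if "u - 1 \<in> local_ideal x (int r)" for u
    using int1[OF that] local_int_add[of "u - 1" x 1] by simp
  have "a \<in> local_int x" "fls_nth a 0 = 1" "e \<in> local_int x" "fls_nth e 0 = 1"
    "b \<in> local_int x" "fls_nth b 0 = 0" "c \<in> local_int x" "fls_nth c 0 = 0"
    using i int1 one by blast+
  then have "mat2 a b c e \<in> GL2 (local_int x)"
    unfolding GL2_local_int_iff
    by (simp add: local_int_nth_mult[of a x e] local_int_nth_mult[of b x c])
  moreover have "\<forall>i j. mat2 a b c e $ i $ j - mat 1 $ i $ j \<in> local_ideal x (int r)"
    using i by (simp add: mat2_one forall_2)
  ultimately show ?l by (simp add: local_level_def)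
qed

text \<open>
  At the level, the second column of \<open>l\<close> is congruent to \<open>(0, 1)\<close> modulo \<open>\<pi>\<^sub>x\<^sup>r\<close>, and what is left of
  the point on the projective line is the class of the upper right entry of \<open>l\<close> modulo \<open>\<pi>\<^sub>x\<^sup>r\<^sup>+\<^sup>1\<close>.  That
  entry is \<open>\<pi>\<^sub>x\<^sup>r b'\<close>, and the residue of \<open>b'\<close> is the constant that indexes the representative.
\<close>

lemma ramified_coset:
  assumes r: "r \<ge> 1" and deg: "place_degree x = 1" and l: "l \<in> local_level x r x"
  shows "\<exists>s. \<exists>l'\<in>local_level x r x. l ** mat2 (unif_at x) 0 0 1 = xi_ram \<pi> x r s ** l'"
proof -
  let ?t = "unif_at x"
  have t: "?t \<noteq> 0" "?t \<in> local_int x" by (fact unif_at)+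
  obtain a b c e where l_eq: "l = mat2 a b c e" by (rule mat2_exhaust)
  have i: "a - 1 \<in> local_ideal x (int r)" "b \<in> local_ideal x (int r)"
    "c \<in> local_ideal x (int r)" "e - 1 \<in> local_ideal x (int r)"
    using l unfolding l_eq local_level_ramified_iff[OF r] by blast+
  obtain b' where b': "b' \<in> local_int x" "b = ?t ^ r * b'"
    using i(2) local_ideal_eq_uniformizer_mult[OF unif] by blast
  have "fls_nth b' 0 \<in> range to_ac" using residue_field_lift[OF b'(1)] residue_field_degree_1[OF deg] by simp
  then obtain s where s: "fls_nth b' 0 = to_ac s" by blast
  let ?S = "fls_const (to_ac s)"
  have S: "?S \<in> local_int x" by (rule local_int_const)
  have e1: "e - 1 \<in> local_ideal x 1" using r i(4) by (intro local_ideal_mono[of 1 "int r"]) simp_all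
  have "b' - ?S \<in> local_ideal x 1"
    using local_ideal_1_iff[OF local_int_diff[OF b'(1) S]] s by simp
  then have "(b' - ?S) - ?S * (e - 1) \<in> local_ideal x 1"
    using local_ideal_mult_int(2)[OF S e1] by (rule local_ideal_diff)
  then have "?t ^ r * ((b' - ?S) - ?S * (e - 1)) \<in> local_ideal x (int r + 1)"
    using local_ideal_uniformizer[OF unif] by blast
  moreover have "?t ^ r * ((b' - ?S) - ?S * (e - 1)) = b - ?S * ?t ^ r * e"
    by (simp add: b'(2) algebra_simps)
  ultimately have u: "(b - ?S * ?t ^ r * e) / ?t \<in> local_ideal x (int r)"
    using local_ideal_div_unif by simp
  have tr: "?t ^ r \<in> local_int x" by (induction r) (auto intro: local_int_mult t)
  have "(a - 1) - ?S * ?t ^ r * c \<in> local_ideal x (int r)"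
    by (rule local_ideal_diff[OF i(1) local_ideal_mult_int(2)[OF local_int_mult[OF S tr] i(3)]])
  moreover have "c * ?t \<in> local_ideal x (int r)" using i(3) t by (intro local_ideal_mult_int)
  moreover have "(a - 1) - ?S * ?t ^ r * c = (a - ?S * ?t ^ r * c) - 1" by (simp add: algebra_simps)
  ultimately have "mat2 (a - ?S * ?t ^ r * c) ((b - ?S * ?t ^ r * e) / ?t) (c * ?t) e \<in> local_level x r x"
    unfolding local_level_ramified_iff[OF r] using u i(4) by simp
  moreover have "l ** mat2 ?t 0 0 1 =
      xi_ram \<pi> x r s ** mat2 (a - ?S * ?t ^ r * c) ((b - ?S * ?t ^ r * e) / ?t) (c * ?t) e"
    using t(1) by (simp add: l_eq xi_ram_def mat2_mult field_simps)
  ultimately show ?thesis by blast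
qed

lemma ramified_representative:
  assumes r: "r \<ge> 1"
  shows "\<exists>l\<in>local_level x r x. \<exists>l'\<in>local_level x r x. xi_ram \<pi> x r s = l ** mat2 (unif_at x) 0 0 1 ** l'"
proof -
  have "fls_const (to_ac s) * unif_at x ^ r \<in> local_ideal x (int r)"
    using local_ideal_eq_uniformizer_mult[OF unif, of "fls_const (to_ac s) * unif_at x ^ r" x r]
      local_int_const[of s x] by (auto simp: mult.commute)
  then have "mat2 1 (fls_const (to_ac s) * unif_at x ^ r) 0 1 \<in> local_level x r x"
    unfolding local_level_ramified_iff[OF r] by simp
  moreover have "mat2 1 0 0 1 \<in> local_level x r x" unfolding local_level_ramified_iff[OF r] by simp
  moreover have "xi_ram \<pi> x r s =
      mat2 1 (fls_const (to_ac s) * unif_at x ^ r) 0 1 ** mat2 (unif_at x) 0 0 1 ** mat2 1 0 0 1"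
    by (simp add: xi_ram_def mat2_mult)
  ultimately show ?thesis by blast
qed

text \<open>
  The upper right entry of \<open>\<xi> l\<close> is congruent to \<open>s \<pi>\<^sub>x\<^sup>r\<close> modulo \<open>\<pi>\<^sub>x\<^sup>r\<^sup>+\<^sup>1\<close>, which determines \<open>s\<close>.
\<close>

lemma ramified_disjoint:
  assumes r: "r \<ge> 1" and l: "l \<in> local_level x r x" "l' \<in> local_level x r x"
    and eq: "xi_ram \<pi> x r s ** l = xi_ram \<pi> x r s' ** l'"
  shows "s = s'"
proof -
  let ?t = "unif_at x" and ?S = "fls_const (to_ac s)" and ?S' = "fls_const (to_ac s')"
  obtain a b c e where m: "l = mat2 a b c e" by (rule mat2_exhaust)
  obtain a' b' c' e' where m': "l' = mat2 a' b' c' e'" by (rule mat2_exhaust)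
  have i: "b \<in> local_ideal x (int r)" "e - 1 \<in> local_ideal x (int r)" "b' \<in> local_ideal x (int r)"
    using l unfolding m m' local_level_ramified_iff[OF r] by blast+
  have "mat2 (?t * a + ?S * ?t ^ r * c) (?t * b + ?S * ?t ^ r * e) c e =
      mat2 (?t * a' + ?S' * ?t ^ r * c') (?t * b' + ?S' * ?t ^ r * e') c' e'"
    using eq by (simp only: m m' xi_ram_def mat2_mult mult_zero_left mult_1_left add_0)
  then have "?t * b + ?S * ?t ^ r * e = ?t * b' + ?S' * ?t ^ r * e'" "e' = e"
    unfolding mat2_eq_iff by blast+
  then have "?t * b + ?S * ?t ^ r * e = ?t * b' + ?S' * ?t ^ r * e" by (simp only:)
  then have "?t ^ 1 * (b - b') = ?t ^ r * ((?S' - ?S) * e)" by (simp add: algebra_simps)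
  moreover have "?t ^ 1 * (b - b') \<in> local_ideal x (int 1 + int r)"
    using local_ideal_uniformizer[OF unif] local_ideal_diff[OF i(1,3)] by blast
  ultimately have "?t ^ r * ((?S' - ?S) * e) \<in> local_ideal x (int r + 1)" by (simp add: add.commute)
  then have "(?S' - ?S) * e \<in> local_ideal x 1" using local_ideal_uniformizer[OF unif] by blast
  then have "fls_nth ((?S' - ?S) * e) 0 = 0" by (simp add: local_ideal_def)
  then have "(to_ac s' - to_ac s) * fls_nth e 0 = 0" by (simp add: algebra_simps)
  moreover have "fls_nth (e - 1) 0 = 0" using i(2) r by (simp add: local_ideal_def del: fls_minus_nth)
  then have "fls_nth e 0 = 1" by simp
  ultimately show ?thesis by simp
qed

end

theorem theorem5p14:
  fixes \<mu> :: "('k::finite_field adele^2^2) measure"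
    and \<pi> :: "'k place \<Rightarrow> 'k poly fract"
    and x y :: "'k place" and r :: nat
    and g :: "'k adele^2^2"
  assumes haar: "haar_measure \<mu>" "emeasure \<mu> (GL2 adele_int) = 1"
    and unif: "\<And>z. uniformizer z (\<pi> z)"
    and r: "r \<ge> 1"
    and x: "place_degree x = 1"
    and y: "y \<noteq> x"
    and g: "g \<in> GL2_adele"
  shows "let K = level_group \<pi> x r;
             N\<^sub>y = neighbors \<mu> K (hecke_kernel \<mu> \<pi> x r y) g;
             m\<^sub>y = multiplicities \<mu> K (hecke_kernel \<mu> \<pi> x r y) g;
             N\<^sub>x = neighbors \<mu> K (hecke_kernel \<mu> \<pi> x r x) g;
             m\<^sub>x = multiplicities \<mu> K (hecke_kernel \<mu> \<pi> x r x) g;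
             P = proj_line (residue_field y);
             v\<^sub>y = (\<lambda>w. vertex K (g ** at_place y (xi \<pi> y w)));
             v\<^sub>x = (\<lambda>a. vertex K (g ** at_place x (xi_ram \<pi> x r a)))
         in (N\<^sub>y = v\<^sub>y ` P \<and>
             (\<forall>w\<in>P. m\<^sub>y (v\<^sub>y w) = of_nat (card {w' \<in> P. v\<^sub>y w' = v\<^sub>y w})) \<and>
             finite N\<^sub>y \<and> (\<Sum>v\<in>N\<^sub>y. m\<^sub>y v) = of_nat (CARD('k) ^ place_degree y + 1)) \<and>
            (N\<^sub>x = range v\<^sub>x \<and>
             (\<forall>a. m\<^sub>x (v\<^sub>x a) = of_nat (card {a'. v\<^sub>x a' = v\<^sub>x a})) \<and>
             finite N\<^sub>x \<and> (\<Sum>v\<in>N\<^sub>x. m\<^sub>x v) = of_nat CARD('k))"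
proof -
  interpret level_haar \<pi> x r \<mu>
    by unfold_locales (fact unif haar)+
  let ?P = "proj_line (residue_field y)"
  have fin: "finite ?P" by (intro finite_proj_line finite_residue_field)
  have card: "card ?P = CARD('k) ^ place_degree y + 1"
    by (simp add: card_proj_line finite_residue_field card_residue_field)
  have level_y: "local_level x r y = GL2 (local_int y)" using y by (rule local_level_unramified)
  note cosets_y = cosets_at_place[where z = y and P = ?P and \<xi> = "xi \<pi> y", OF hecke_matrix_GL2 xi_GL2,
      unfolded level_y, OF _ unramified_coset unramified_representative unramified_disjoint]
  note neighbors_y = neighbors_of_coset_representatives[where z = y and P = ?P and
      \<Xi> = "\<lambda>w. at_place y (xi \<pi> y w)", OF fin at_place_GL2[OF xi_GL2] cosets_y g]
  note cosets_x = cosets_at_place[where z = x and P = UNIV and \<xi> = "xi_ram \<pi> x r", OF hecke_matrix_GL2 xi_ram_GL2,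
      simplified bex_UNIV, OF ramified_coset[OF r x] ramified_representative[OF r] ramified_disjoint[OF r]]
  note neighbors_x = neighbors_of_coset_representatives[where z = x and P = UNIV and
      \<Xi> = "\<lambda>a. at_place x (xi_ram \<pi> x r a)", OF finite at_place_GL2[OF xi_ram_GL2] cosets_x g]
  show ?thesis
    unfolding Let_def using neighbors_y neighbors_x by (simp add: card)
qed

end
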